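(* Let $F:[0,1]\to\mathbb{R}$, $F\in W^{1,2}([0,1])$, be a concave function such that $F(0)=F(1)=0$, and let $F$ satisfy the growth condition $$F(s)\le C_1 s^{\alpha},\qquad F(s)\le C_2(1-s)^{\alpha}$$ with some constants $C_1,C_2>0$ and $\alpha>1/2$. Then any profile $s$ satisfies the inequality $$\int_{\mathbb{R}}F(s)\,dz\le\mathcal{C}\left(\int_{\mathbb{R}}(s-s_0)\,z\,dz\right)^{1/2},$$ with the sharp constant $$\mathcal{C}=\mathcal{C}(F)=\left(2\int_0^1(F'(s))^2\,ds\right)^{1/2}.$$ Further, the inequality is sharp (that is, it holds with equality) if and only if $s$ is a rarefaction wave profile to the Riemann problem for the hyperbolic conservation law $$s_\tau+(F(s))_z=0,\qquad s(z,0)=s_0(z).$$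
   Context: A profile is a measurable function $s:\mathbb{R}\to[0,1]$ satisfying $s(z)\to1$ as $z\to-\infty$ and $s(z)\to0$ as $z\to+\infty$. The stratified profile $s_0$ is $s_0(z)=1$ for $z<0$ and $s_0(z)=0$ for $z\ge0$. A rarefaction wave profile of the Riemann problem is a profile given by $\tau F'(s(z))=z$ for some $\tau>0$ (in the region where $s$ passes from $1$ to $0$, with $s=1$ to the left of this region and $s=0$ to the right of it).
   Formalization: The "only if" part of the equality claim excludes F identically 0, s equal to s_0 a.e., and profiles with infinite right-hand integral, where it fails or is meaningless; being a rarefaction wave profile is understood up to null sets, with F' read as the superdifferential of F. *)

theory Defs
  imports "HOL-Analysis.Analysis"
begin

definition L2_unit :: "(real \<Rightarrow> real) \<Rightarrow> bool" where
  "L2_unit f \<longleftrightarrow>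
     set_borel_measurable lebesgue {0<..<1} f \<and>
     set_integrable lebesgue {0<..<1} (\<lambda>x. (f x)\<^sup>2)"

text \<open>Test functions are the continuously differentiable functions with compact support in the open
  interval (0,1), as is usual in dimension one; by mollification they define the same weak
  derivatives as smooth test functions.\<close>

definition weak_derivative_unit :: "(real \<Rightarrow> real) \<Rightarrow> (real \<Rightarrow> real) \<Rightarrow> bool" where
  "weak_derivative_unit f f' \<longleftrightarrow>
     (\<forall>\<phi> \<phi>'. (\<forall>x. (\<phi> has_real_derivative \<phi>' x) (at x)) \<longrightarrow>
             continuous_on UNIV \<phi>' \<longrightarrow>
             (\<exists>a b. 0 < a \<and> a \<le> b \<and> b < 1 \<and> (\<forall>x. x \<notin> {a..b} \<longrightarrow> \<phi> x = 0)) \<longrightarrow>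
             (LINT x:{0<..<1}|lebesgue. f x * \<phi>' x) = - (LINT x:{0<..<1}|lebesgue. f' x * \<phi> x))"

text \<open>\<open>f\<close> belongs to the Sobolev space W(1,2) on (0,1), and \<open>f'\<close> represents its derivative (which is unique
  up to a null set).\<close>

definition W12_unit :: "(real \<Rightarrow> real) \<Rightarrow> (real \<Rightarrow> real) \<Rightarrow> bool" where
  "W12_unit f f' \<longleftrightarrow> L2_unit f \<and> L2_unit f' \<and> weak_derivative_unit f f'"

definition profile :: "(real \<Rightarrow> real) \<Rightarrow> bool" where
  "profile s \<longleftrightarrow>
     s \<in> borel_measurable lebesgue \<and> (\<forall>z. s z \<in> {0..1}) \<and>
     (s \<longlongrightarrow> 1) at_bot \<and> (s \<longlongrightarrow> 0) at_top"

definition stratified :: "real \<Rightarrow> real" where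
  "stratified z = (if z < 0 then 1 else 0)"

text \<open>Both integrals below have nonnegative integrands: \<open>F \<ge> 0\<close> on [0,1] if \<open>F\<close> is concave and
  vanishes at the end points, and \<open>s - stratified\<close> has the sign of \<open>z\<close>. They are
  therefore taken with values in [0,\<open>\<infinity>\<close>], and nothing is truncated by \<open>ennreal\<close>.\<close>

definition flux_integral :: "(real \<Rightarrow> real) \<Rightarrow> (real \<Rightarrow> real) \<Rightarrow> ennreal" where
  "flux_integral F s = (\<integral>\<^sup>+ z. ennreal (F (s z)) \<partial>lebesgue)"

definition moment_integral :: "(real \<Rightarrow> real) \<Rightarrow> ennreal" where
  "moment_integral s = (\<integral>\<^sup>+ z. ennreal ((s z - stratified z) * z) \<partial>lebesgue)"

definition ennreal_sqrt :: "ennreal \<Rightarrow> ennreal" where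
  "ennreal_sqrt x = (if x = \<infinity> then \<infinity> else ennreal (sqrt (enn2real x)))"

definition sharp_const :: "(real \<Rightarrow> real) \<Rightarrow> real" where
  "sharp_const F' = sqrt (2 * (LINT x:{0<..<1}|lebesgue. (F' x)\<^sup>2))"

text \<open>A concave flux need not be differentiable everywhere, so the value \<open>F'(x)\<close> in the relation
  \<open>\<tau> F'(s(z)) = z\<close> is read as any element of the superdifferential of \<open>F\<close> on [0,1]. Where \<open>F\<close> is
  differentiable in the open interval this is the single value \<open>F'(x)\<close>; at a corner it is the
  interval of slopes between the one-sided derivatives, so that \<open>s\<close> is constant on the
  corresponding range of \<open>z\<close>. At the end points it is a half-line, which encodes that
  \<open>s = 1\<close> to the left and \<open>s = 0\<close> to the right of the fan
  \<open>\<tau> F'(1-) < z < \<tau> F'(0+)\<close>. See the lemmas \<open>superdiff_differentiable\<close>,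
  \<open>superdiff_0\<close> and \<open>superdiff_1\<close>.\<close>

definition superdiff :: "(real \<Rightarrow> real) \<Rightarrow> real \<Rightarrow> real set" where
  "superdiff F x = {p. \<forall>y\<in>{0..1}. F y \<le> F x + p * (y - x)}"

definition rarefaction_profile :: "(real \<Rightarrow> real) \<Rightarrow> (real \<Rightarrow> real) \<Rightarrow> bool" where
  "rarefaction_profile F s \<longleftrightarrow>
     profile s \<and> (\<exists>\<tau>>0. \<forall>z. \<exists>p\<in>superdiff F (s z). \<tau> * p = z)"

lemma derivative_in_superdiff:
  assumes F: "concave_on {0..1} F" and x: "x \<in> {0..1}"
    and D: "(F has_real_derivative D) (at x within {0..1})"
  shows "D \<in> superdiff F x"
  unfolding superdiff_def
proof (intro CollectI ballI)
  fix y :: real assume y: "y \<in> {0..1}"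
  define g where "g t = F (x + t * (y - x))" for t :: real
  have cv: "x + t * (y - x) \<in> {0..1}" if "t \<in> {0..1}" for t
  proof -
    have "(1 - t) *\<^sub>R x + t *\<^sub>R y \<in> {0..1}"
      using that x y by (intro convexD) auto
    then show ?thesis by (simp add: algebra_simps)
  qed
  have "(F \<circ> (\<lambda>t. x + t * (y - x)) has_real_derivative D * (y - x)) (at 0 within {0..1})"
  proof (rule DERIV_image_chain)
    show "(F has_real_derivative D) (at (x + 0 * (y - x)) within ((\<lambda>t. x + t * (y - x)) ` {0..1}))"
    proof -
      have "(F has_real_derivative D) (at x within ((\<lambda>t. x + t * (y - x)) ` {0..1}))"
        by (rule DERIV_subset[OF D]) (use cv in blast)
      then show ?thesis by simp
    qed
  qed (auto intro!: derivative_eq_intros)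
  then have "(g has_real_derivative D * (y - x)) (at 0 within {0..1})"
    by (simp add: g_def[abs_def] comp_def)
  then have "((\<lambda>t. (g t - g 0) / (t - 0)) \<longlongrightarrow> D * (y - x)) (at 0 within {0..1})"
    by (simp add: has_field_derivative_iff)
  moreover have "at (0::real) within {0..1} \<noteq> bot"
    by (simp add: trivial_limit_within islimpt_Icc)
  moreover have "\<forall>\<^sub>F t in at 0 within {0..1}. F y - F x \<le> (g t - g 0) / (t - 0)"
    unfolding eventually_at_filter
  proof (intro always_eventually allI impI)
    fix t :: real assume t: "t \<noteq> 0" "t \<in> {0..1}"
    have "(1 - t) * F x + t * F y \<le> F ((1 - t) *\<^sub>R x + t *\<^sub>R y)"
      using concave_onD[OF F, of t x y] t x y by auto
    then have "t * (F y - F x) \<le> g t - g 0"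
      by (simp add: g_def algebra_simps)
    then show "F y - F x \<le> (g t - g 0) / (t - 0)"
      using t by (simp add: field_simps)
  qed
  ultimately have "F y - F x \<le> D * (y - x)"
    by (intro tendsto_lowerbound)
  then show "F y \<le> F x + D * (y - x)" by simp
qed

lemma superdiff_le_right:
  assumes x: "0 \<le> x" "x < 1" and p: "p \<in> superdiff F x"
    and D: "(F has_real_derivative D) (at x within {0..1})"
  shows "D \<le> p"
proof -
  have "(F has_real_derivative D) (at x within {x..1})"
    using D x by (auto intro: DERIV_subset)
  then have "((\<lambda>y. (F y - F x) / (y - x)) \<longlongrightarrow> D) (at x within {x..1})"
    by (simp add: has_field_derivative_iff)
  moreover have "at x within {x..1} \<noteq> bot"
    using x by (simp add: trivial_limit_within islimpt_Icc)
  moreover have "\<forall>\<^sub>F y in at x within {x..1}. (F y - F x) / (y - x) \<le> p"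
    unfolding eventually_at_filter
  proof (intro always_eventually allI impI)
    fix y assume y: "y \<noteq> x" "y \<in> {x..1}"
    then have "F y \<le> F x + p * (y - x)" using p x by (auto simp: superdiff_def)
    then show "(F y - F x) / (y - x) \<le> p" using y by (simp add: divide_simps)
  qed
  ultimately show ?thesis by (intro tendsto_upperbound)
qed

lemma superdiff_ge_left:
  assumes x: "0 < x" "x \<le> 1" and p: "p \<in> superdiff F x"
    and D: "(F has_real_derivative D) (at x within {0..1})"
  shows "p \<le> D"
proof -
  have "(F has_real_derivative D) (at x within {0..x})"
    using D x by (auto intro: DERIV_subset)
  then have "((\<lambda>y. (F y - F x) / (y - x)) \<longlongrightarrow> D) (at x within {0..x})"
    by (simp add: has_field_derivative_iff)
  moreover have "at x within {0..x} \<noteq> bot"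
    using x by (simp add: trivial_limit_within islimpt_Icc)
  moreover have "\<forall>\<^sub>F y in at x within {0..x}. p \<le> (F y - F x) / (y - x)"
    unfolding eventually_at_filter
  proof (intro always_eventually allI impI)
    fix y assume y: "y \<noteq> x" "y \<in> {0..x}"
    then have "F y \<le> F x + p * (y - x)" using p x by (auto simp: superdiff_def)
    then show "p \<le> (F y - F x) / (y - x)" using y by (simp add: divide_simps)
  qed
  ultimately show ?thesis by (intro tendsto_lowerbound)
qed

lemma superdiff_differentiable:
  assumes "concave_on {0..1} F" "0 < x" "x < 1" "(F has_real_derivative D) (at x)"
  shows "superdiff F x = {D}"
proof -
  have D: "(F has_real_derivative D) (at x within {0..1})"
    using assms(4) by (rule has_field_derivative_at_within)
  show ?thesis
    using derivative_in_superdiff[OF assms(1) _ D] superdiff_le_right[OF _ _ _ D]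
      superdiff_ge_left[OF _ _ _ D] assms(2,3) by (auto intro: antisym)
qed

lemma superdiff_0:
  assumes "concave_on {0..1} F" "(F has_real_derivative D) (at 0 within {0..1})"
  shows "superdiff F 0 = {D..}"
proof -
  have "p \<in> superdiff F 0" if "D \<le> p" for p
    using derivative_in_superdiff[OF assms(1) _ assms(2)] that
    by (fastforce simp: superdiff_def intro: order_trans mult_right_mono)
  then show ?thesis
    using superdiff_le_right[OF _ _ _ assms(2)] by auto
qed

lemma superdiff_1:
  assumes "concave_on {0..1} F" "(F has_real_derivative D) (at 1 within {0..1})"
  shows "superdiff F 1 = {..D}"
proof -
  have "p \<in> superdiff F 1" if "p \<le> D" for p
    using derivative_in_superdiff[OF assms(1) _ assms(2)] that
    by (fastforce simp: superdiff_def intro: order_trans mult_right_mono_neg)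
  then show ?thesis
    using superdiff_ge_left[OF _ _ _ assms(2)] by auto
qed

end

theory Submission
  imports Defs
begin

text \<open>The inequality is an integrated Young inequality. For \<open>\<tau> > 0\<close> and every \<open>z\<close>,
  \<open>\<tau> F(s) \<le> (s - s\<^sub>0(z)) z + \<tau> \<psi>(z/\<tau>)\<close> with
  \<open>\<psi>(w) = max\<^sub>\<sigma> (F(\<sigma>) - (\<sigma> - s\<^sub>0(w)) w) = (\<integral>\<^sub>0\<^sup>1 \<bar>F' - w\<bar> - \<bar>w\<bar>) / 2\<close>,
  and equality holds exactly if \<open>z/\<tau>\<close> is a supergradient of \<open>F\<close> at \<open>s\<close>, which is the equation of
  a rarefaction wave. By Tonelli \<open>\<integral> \<psi> = Q/2\<close> with \<open>Q = \<integral>\<^sub>0\<^sup>1 F'\<^sup>2\<close>, so integrating gives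
  \<open>\<tau> A \<le> M + \<tau>\<^sup>2 Q/2\<close> for the flux integral \<open>A\<close> and the moment integral \<open>M\<close>; the best \<open>\<tau>\<close> yields
  \<open>A \<le> sqrt (2 Q M)\<close>. If equality holds for some \<open>\<tau>\<close>, then \<open>(A - \<tau> Q)\<^sup>2 = A\<^sup>2 - 2 Q M \<le> 0\<close>,
  so \<open>A = sqrt (2 Q M)\<close>.\<close>

section \<open>Increments of functions with a weak derivative\<close>

definition smoothstep :: "real \<Rightarrow> real" where
  "smoothstep u = ((max 0 (u + 1))\<^sup>2 - 2 * (max 0 u)\<^sup>2 + (max 0 (u - 1))\<^sup>2) / 2"

text \<open>This is the hat function 1 - |u| on [-1,1], zero elsewhere. Truncated powers make
  \<open>smoothstep\<close> its antiderivative by a single formula, so that a difference of two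
  rescaled steps is a C^1 test function.\<close>

definition tent :: "real \<Rightarrow> real" where
  "tent u = max 0 (u + 1) - 2 * max 0 u + max 0 (u - 1)"

lemma has_real_derivative_max_square:
  "((\<lambda>x::real. (max 0 x)\<^sup>2) has_real_derivative 2 * max 0 x) (at x)"
proof -
  consider "x < 0" | "x = 0" | "0 < x" by linarith
  then show ?thesis
  proof cases
    case 1
    have "((\<lambda>x. 0) has_real_derivative 2 * max 0 x) (at x)"
      using 1 by (auto intro!: derivative_eq_intros)
    then show ?thesis
      by (rule has_field_derivative_transform_within_open[of _ _ _ "{..<0}"]) (use 1 in auto)
  next
    case 3
    have "((\<lambda>x. x\<^sup>2) has_real_derivative 2 * max 0 x) (at x)"
      using 3 by (auto intro!: derivative_eq_intros)
    then show ?thesis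
      by (rule has_field_derivative_transform_within_open[of _ _ _ "{0<..}"]) (use 3 in auto)
  next
    case 2
    \<comment> \<open>The only delicate point is the kink, where the difference quotient is bounded
      by |h|.\<close>
    have "((\<lambda>h::real. (max 0 h)\<^sup>2 / h) \<longlongrightarrow> 0) (at 0)"
    proof (rule Lim_null_comparison)
      show "\<forall>\<^sub>F h in at 0. norm ((max 0 h)\<^sup>2 / h) \<le> \<bar>h\<bar>"
        by (intro always_eventually allI) (auto simp: max_def power2_eq_square)
      show "((\<lambda>h::real. \<bar>h\<bar>) \<longlongrightarrow> 0) (at 0)"
        by (rule tendsto_eq_intros refl | simp)+
    qed
    then show ?thesis
      unfolding 2 has_field_derivative_iff by simp
  qed
qed

lemma DERIV_smoothstep: "(smoothstep has_real_derivative tent u) (at u)"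
proof -
  have "((\<lambda>u. (max 0 (u + c))\<^sup>2) has_real_derivative 2 * max 0 (u + c)) (at u)" for c
    using has_real_derivative_max_square[of "u + c"] unfolding DERIV_shift .
  note d = this[of 1] this[of 0] this[of "-1"]
  have "((\<lambda>u. ((max 0 (u + 1))\<^sup>2 - 2 * (max 0 (u + 0))\<^sup>2 + (max 0 (u + -1))\<^sup>2) / 2) has_real_derivative
    (2 * max 0 (u + 1) - 2 * (2 * max 0 (u + 0)) + 2 * max 0 (u + -1)) / 2) (at u)"
    by (intro DERIV_cdivide DERIV_add DERIV_diff DERIV_cmult d)
  moreover have "(2 * max 0 (u + 1) - 2 * (2 * max 0 (u + 0)) + 2 * max 0 (u + -1)) / 2 = tent u"
    by (simp add: tent_def)
  ultimately show ?thesis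
    unfolding smoothstep_def[abs_def] by simp
qed

lemma continuous_tent: "continuous_on UNIV tent"
  unfolding tent_def[abs_def] by (intro continuous_intros)

lemma borel_measurable_tent [measurable]: "tent \<in> borel_measurable borel"
  using continuous_tent by (rule borel_measurable_continuous_onI)

lemma smoothstep_eq_0: "u \<le> -1 \<Longrightarrow> smoothstep u = 0"
  and smoothstep_eq_1: "1 \<le> u \<Longrightarrow> smoothstep u = 1"
  and tent_eq_0: "1 \<le> \<bar>u\<bar> \<Longrightarrow> tent u = 0"
  and tent_nonneg: "0 \<le> tent u"
  by (auto simp: smoothstep_def tent_def max_def abs_if power2_eq_square algebra_simps)

lemma smoothstep_bounds: "0 \<le> smoothstep u" "smoothstep u \<le> 1"
proof -
  have mono: "smoothstep x \<le> smoothstep y" if "x \<le> y" for x y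
    using that DERIV_smoothstep tent_nonneg
    by (intro DERIV_nonneg_imp_nondecreasing[of x y smoothstep]) blast+
  show "0 \<le> smoothstep u" using mono[of "min u (-1)" u] smoothstep_eq_0[of "min u (-1)"] by simp
  show "smoothstep u \<le> 1" using mono[of u "max u 1"] smoothstep_eq_1[of "max u 1"] by simp
qed

lemma integrable_tent: "integrable lborel tent" and integral_tent: "(LINT u|lborel. tent u) = 1"
proof -
  have eq: "tent = (\<lambda>u. indicator {-1..1} u *\<^sub>R tent u)"
  proof
    fix u show "tent u = indicator {-1..1} u *\<^sub>R tent u"
      using tent_eq_0[of u] by (cases "u \<in> {-1..1}") auto
  qed
  have c: "continuous_on {-1..1} tent" using continuous_tent by (rule continuous_on_subset) auto
  from borel_integrable_atLeastAtMost'[OF c] show "integrable lborel tent"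
    unfolding set_integrable_def eq[symmetric] .
  have "(LINT u|lborel. indicator {-1..1} u *\<^sub>R tent u) = smoothstep 1 - smoothstep (-1)"
    using c by (intro integral_FTC_atLeastAtMost)
      (auto simp flip: has_real_derivative_iff_has_vector_derivative
        intro: has_field_derivative_at_within DERIV_smoothstep)
  then show "(LINT u|lborel. tent u) = 1"
    unfolding eq[symmetric] by (simp add: smoothstep_eq_0 smoothstep_eq_1)
qed

text \<open>The substitution x = a + u/(n+1) moves the scaling from the kernel into the argument of
  \<open>h\<close>; dominated convergence under \<open>B * tent\<close> and the unit mass of
  \<open>tent\<close> then give the limit.\<close>

lemma integral_tent_mollifier_tendsto:
  assumes [measurable]: "h \<in> borel_measurable borel" and B: "\<And>x. \<bar>h x\<bar> \<le> B" and a: "isCont h a"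
  shows "(\<lambda>n. LINT x|lborel. h x * (real (Suc n) * tent (real (Suc n) * (x - a)))) \<longlonglongrightarrow> h a"
proof -
  have "(LINT x|lborel. h x * (real (Suc n) * tent (real (Suc n) * (x - a))))
      = (LINT u|lborel. h (a + u / real (Suc n)) * tent u)" for n
    by (subst lborel_integral_real_affine[of "1 / real (Suc n)" _ a])
       (auto simp: field_simps simp del: of_nat_Suc simp flip: integral_mult_right_zero)
  moreover have "(\<lambda>n. LINT u|lborel. h (a + u / real (Suc n)) * tent u)
      \<longlonglongrightarrow> (LINT u|lborel. h a * tent u)"
  proof (rule integral_dominated_convergence)
    show "integrable lborel (\<lambda>u. B * tent u)" using integrable_tent by simp
    show "AE u in lborel. (\<lambda>n. h (a + u / real (Suc n)) * tent u) \<longlonglongrightarrow> h a * tent u"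
    proof (intro AE_I2 tendsto_mult tendsto_const isCont_tendsto_compose[OF a])
      fix u
      have "(\<lambda>n. u / real (Suc n)) \<longlonglongrightarrow> 0"
        by (rule LIMSEQ_Suc) (rule lim_const_over_n)
      from tendsto_add[OF tendsto_const[of a] this]
      show "(\<lambda>n. a + u / real (Suc n)) \<longlonglongrightarrow> a" by simp
    qed
    show "AE u in lborel. norm (h (a + u / real (Suc n)) * tent u) \<le> B * tent u" for n
      using B tent_nonneg by (intro AE_I2) (simp add: abs_mult mult_right_mono)
  qed measurable
  ultimately show ?thesis by (simp add: integral_tent)
qed

text \<open>The weak derivative is tested with a smoothed indicator of [a,b]. Its derivative is an
  approximate point mass at a minus one at b, so one side of the weak identity tends to F a - F b
  and the other to minus the integral of \<open>F'\<close> over [a,b].\<close>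

lemma weak_derivative_unit_increment:
  assumes wd: "weak_derivative_unit F F'" and cont: "continuous_on {0<..<1} F"
    and B: "\<And>x. x \<in> {0<..<1} \<Longrightarrow> \<bar>F x\<bar> \<le> B" and F': "set_integrable lebesgue {0<..<1} F'"
    and ab: "0 < a" "a < b" "b < 1"
  shows "(LINT x:{a..b}|lebesgue. F' x) = F b - F a"
proof -
  \<comment> \<open>Extension by zero gives a bounded Borel function on the whole line, as the
    mollifier lemma demands.\<close>
  define h where "h x = indicator {0<..<1} x * F x" for x :: real
  have h: "h \<in> borel_measurable borel"
    using borel_measurable_continuous_on_indicator[OF _ cont] by (simp add: h_def[abs_def])
  have hB: "\<bar>h x\<bar> \<le> \<bar>B\<bar>" for x
    using B[of x] by (auto simp: h_def indicator_def)
  have hcont: "isCont h c" if "0 < c" "c < 1" for c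
  proof -
    have "continuous_on {0<..<1} h" by (rule continuous_on_eq[OF cont]) (simp add: h_def)
    then show ?thesis using that by (simp add: continuous_on_eq_continuous_at)
  qed
  define \<phi> where "\<phi> n x = smoothstep (real (Suc n) * (x - a)) - smoothstep (real (Suc n) * (x - b))" for n x
  define m where "m c n x = real (Suc n) * tent (real (Suc n) * (x - c))" for c :: real and n x
  have D: "(\<phi> n has_real_derivative m a n x - m b n x) (at x)" for n x
  proof -
    have "((\<lambda>x. smoothstep (real (Suc n) * (x - c))) has_real_derivative m c n x) (at x)" for c
    proof -
      have "((\<lambda>x. real (Suc n) * (x - c)) has_real_derivative real (Suc n)) (at x)"
        by (auto intro!: derivative_eq_intros)
      from DERIV_chain2[OF DERIV_smoothstep this] show ?thesis
        by (simp add: m_def mult.commute)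
    qed
    then show ?thesis unfolding \<phi>_def[abs_def] by (intro DERIV_diff)
  qed
  have m_cont: "continuous_on UNIV (m c n)" for c n
    unfolding m_def[abs_def] tent_def by (intro continuous_intros)
  have m_meas [measurable]: "m c n \<in> borel_measurable borel" for c n
    using m_cont by (rule borel_measurable_continuous_onI)
  have m_int: "integrable lborel (\<lambda>x. h x * m c n x)" for c n
  proof (rule Bochner_Integration.integrable_bound)
    have "integrable lborel (\<lambda>x. tent (- (real (Suc n) * c) + real (Suc n) * x))"
      by (intro lborel_integrable_real_affine integrable_tent) simp
    then have "integrable lborel (m c n)"
      unfolding m_def[abs_def] by (simp add: algebra_simps del: of_nat_Suc)
    then show "integrable lborel (\<lambda>x. \<bar>B\<bar> * m c n x)" by simp
    have "0 \<le> m c n x" for x by (simp add: m_def tent_nonneg)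
    then show "AE x in lborel. norm (h x * m c n x) \<le> norm (\<bar>B\<bar> * m c n x)"
      using hB by (intro AE_I2) (simp add: abs_mult mult_right_mono)
  qed (use h in measurable)
  have "(\<lambda>n. (LINT x|lborel. h x * m a n x) - (LINT x|lborel. h x * m b n x)) \<longlonglongrightarrow> h a - h b"
    unfolding m_def using ab
    by (intro tendsto_diff integral_tent_mollifier_tendsto[OF h hB] hcont) auto
  then have lim1: "(\<lambda>n. LINT x:{0<..<1}|lebesgue. F x * (m a n x - m b n x)) \<longlonglongrightarrow> F a - F b"
  proof (rule Lim_transform_eventually[THEN tendsto_eq_rhs])
    show "h a - h b = F a - F b" using ab by (simp add: h_def)
    have [measurable]: "h \<in> borel_measurable borel" by (rule h)
    have "(LINT x|lborel. h x * m a n x) - (LINT x|lborel. h x * m b n x)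
        = (LINT x:{0<..<1}|lebesgue. F x * (m a n x - m b n x))" for n
    proof -
      have "(LINT x|lborel. h x * m a n x) - (LINT x|lborel. h x * m b n x)
          = (LINT x|lborel. h x * m a n x - h x * m b n x)"
        by (intro Bochner_Integration.integral_diff[symmetric] m_int)
      also have "\<dots> = (LINT x|lebesgue. h x * m a n x - h x * m b n x)"
        by (rule integral_completion[symmetric]) measurable
      also have "\<dots> = (LINT x:{0<..<1}|lebesgue. F x * (m a n x - m b n x))"
        unfolding set_lebesgue_integral_def
        by (intro Bochner_Integration.integral_cong) (auto simp: h_def algebra_simps)
      finally show ?thesis .
    qed
    then show "\<forall>\<^sub>F n in sequentially. (LINT x|lborel. h x * m a n x) - (LINT x|lborel. h x * m b n x)
        = (LINT x:{0<..<1}|lebesgue. F x * (m a n x - m b n x))" by simp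
  qed
  \<comment> \<open>Half the smaller distance of a and b from the end points. Once n + 1 \<ge> 1/d,
    the ramps of \<open>\<phi> n\<close> have half-width at most d, so its support is a compact
    subset of (0,1).\<close>
  define d where "d = min a (1 - b) / 2"
  have d: "0 < d" "d < a" "b + d < 1" using ab by (auto simp: d_def min_def field_simps)
  obtain N where "1 / d < real N" using reals_Archimedean2 by blast
  then have N: "1 \<le> real (Suc n) * d" if "N \<le> n" for n
  proof -
    have "1 / d \<le> real (Suc n)" using \<open>1 / d < real N\<close> that by simp
    then show ?thesis using d by (simp add: field_simps)
  qed
  have test: "\<phi> n x = 0" if n: "N \<le> n" and x: "x \<notin> {a - d..b + d}" for n x
  proof (cases "x < a - d")
    case True
    have "real (Suc n) * (x - c) \<le> -1" if "a \<le> c" for c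
    proof -
      have "real (Suc n) * (x - c) \<le> real (Suc n) * (- d)"
        using True that by (intro mult_left_mono) auto
      then show ?thesis using N[OF n] by simp
    qed
    then show ?thesis using ab by (simp add: \<phi>_def smoothstep_eq_0 del: of_nat_Suc)
  next
    case False
    have "1 \<le> real (Suc n) * (x - c)" if "c \<le> b" for c
    proof -
      have "real (Suc n) * d \<le> real (Suc n) * (x - c)"
        using False x that by (intro mult_left_mono) auto
      then show ?thesis using N[OF n] by linarith
    qed
    then show ?thesis using ab by (simp add: \<phi>_def smoothstep_eq_1 del: of_nat_Suc)
  qed
  have "(LINT x:{0<..<1}|lebesgue. F x * (m a n x - m b n x)) = - (LINT x:{0<..<1}|lebesgue. F' x * \<phi> n x)"
    if "N \<le> n" for n
  proof (rule wd[unfolded weak_derivative_unit_def, rule_format])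
    show "\<exists>a b. 0 < a \<and> a \<le> b \<and> b < 1 \<and> (\<forall>x. x \<notin> {a..b} \<longrightarrow> \<phi> n x = 0)"
      using test[OF that] d ab by (intro exI[of _ "a - d"] exI[of _ "b + d"]) auto
    show "continuous_on UNIV (\<lambda>x. m a n x - m b n x)" by (intro continuous_intros m_cont)
  qed (rule D)
  then have "\<forall>\<^sub>F n in sequentially. (LINT x:{0<..<1}|lebesgue. F x * (m a n x - m b n x))
      = - (LINT x:{0<..<1}|lebesgue. F' x * \<phi> n x)"
    by (auto simp: eventually_sequentially)
  with lim1 have lim2: "(\<lambda>n. - (LINT x:{0<..<1}|lebesgue. F' x * \<phi> n x)) \<longlonglongrightarrow> F a - F b"
    by (rule Lim_transform_eventually)
  have \<phi>_meas: "\<phi> n \<in> borel_measurable lebesgue" for n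
    by (intro measurable_completion) (auto intro!: borel_measurable_continuous_onI
        continuous_at_imp_continuous_on DERIV_isCont[OF D])
  have "(\<lambda>n. LINT x:{0<..<1}|lebesgue. F' x * \<phi> n x)
      \<longlonglongrightarrow> (LINT x:{0<..<1}|lebesgue. F' x * indicator {a..b} x)"
    unfolding set_lebesgue_integral_def
  proof (rule integral_dominated_convergence)
    have int: "integrable lebesgue (\<lambda>x. indicator {0<..<1} x *\<^sub>R F' x)"
      using F' by (simp add: set_integrable_def)
    then show "integrable lebesgue (\<lambda>x. 1 * \<bar>indicator {0<..<1} x *\<^sub>R F' x\<bar>)" by simp
    from int have F'_meas: "(\<lambda>x. indicator {0<..<1} x *\<^sub>R F' x) \<in> borel_measurable lebesgue"
      by (rule borel_measurable_integrable)
    have "(\<lambda>x. (indicator {0<..<1} x *\<^sub>R F' x) * \<phi> n x) \<in> borel_measurable lebesgue" for n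
      by (intro borel_measurable_times \<phi>_meas F'_meas)
    then show "(\<lambda>x. indicator {0<..<1} x *\<^sub>R (F' x * \<phi> n x)) \<in> borel_measurable lebesgue" for n
      by (simp add: mult.assoc)
    have "(\<lambda>x. (indicator {0<..<1} x *\<^sub>R F' x) * indicator {a..b} x) \<in> borel_measurable lebesgue"
      by (intro borel_measurable_times F'_meas borel_measurable_indicator) auto
    then show "(\<lambda>x. indicator {0<..<1} x *\<^sub>R (F' x * indicator {a..b} x)) \<in> borel_measurable lebesgue"
      by (simp add: mult.assoc)
    have "\<bar>\<phi> n x\<bar> \<le> 1" for n x
      using smoothstep_bounds[of "real (Suc n) * (x - a)"] smoothstep_bounds[of "real (Suc n) * (x - b)"]
      unfolding \<phi>_def by linarith
    then have "\<bar>F' x\<bar> * \<bar>\<phi> n x\<bar> \<le> \<bar>F' x\<bar> * 1" for n x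
      by (intro mult_left_mono) auto
    then show "AE x in lebesgue. norm (indicator {0<..<1} x *\<^sub>R (F' x * \<phi> n x))
        \<le> 1 * \<bar>indicator {0<..<1} x *\<^sub>R F' x\<bar>" for n
      by (intro AE_I2) (auto simp: abs_mult indicator_def)
    have scaled: "LIM n sequentially. real (Suc n) * y :> at_top" if "0 < y" for y
      using that
      by (intro filterlim_at_top_mult_tendsto_pos[OF tendsto_const]
            filterlim_compose[OF filterlim_real_sequentially filterlim_Suc] | simp add: mult.commute)+
    have step1: "(\<lambda>n. smoothstep (real (Suc n) * y)) \<longlonglongrightarrow> 1" if "0 < y" for y
    proof (rule tendsto_eventually)
      have "\<forall>\<^sub>F n in sequentially. 1 \<le> real (Suc n) * y"
        using scaled[OF that] unfolding filterlim_at_top by blast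
      then show "\<forall>\<^sub>F n in sequentially. smoothstep (real (Suc n) * y) = 1"
        by eventually_elim (rule smoothstep_eq_1)
    qed
    have step0: "(\<lambda>n. smoothstep (real (Suc n) * y)) \<longlonglongrightarrow> 0" if "y < 0" for y
    proof (rule tendsto_eventually)
      have "0 < - y" using that by simp
      from scaled[OF this] have "\<forall>\<^sub>F n in sequentially. 1 \<le> real (Suc n) * (- y)"
        unfolding filterlim_at_top by blast
      then show "\<forall>\<^sub>F n in sequentially. smoothstep (real (Suc n) * y) = 0"
        by eventually_elim (rule smoothstep_eq_0, simp)
    qed
    \<comment> \<open>At a and b themselves \<open>\<phi> n\<close> tends to 1/2 and not to the
      indicator.\<close>
    have "AE x in lebesgue. x \<noteq> a" "AE x in lebesgue. x \<noteq> b"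
      by (rule AE_completion, rule AE_lborel_singleton)+
    then show "AE x in lebesgue. (\<lambda>n. indicator {0<..<1} x *\<^sub>R (F' x * \<phi> n x))
        \<longlonglongrightarrow> indicator {0<..<1} x *\<^sub>R (F' x * indicator {a..b} x)"
    proof eventually_elim
      fix x assume x: "x \<noteq> a" "x \<noteq> b"
      have "(\<lambda>n. \<phi> n x) \<longlonglongrightarrow> indicator {a..b} x"
      proof -
        consider "x < a" | "a < x" "x < b" | "b < x" using x by linarith
        then show ?thesis
        proof cases
          case 1
          then show ?thesis
            using tendsto_diff[OF step0[of "x - a"] step0[of "x - b"]] ab by (simp add: \<phi>_def)
        next
          case 2
          then show ?thesis
            using tendsto_diff[OF step1[of "x - a"] step0[of "x - b"]] ab by (simp add: \<phi>_def)
        next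
          case 3
          then show ?thesis
            using tendsto_diff[OF step1[of "x - a"] step1[of "x - b"]] ab by (simp add: \<phi>_def)
        qed
      qed
      then show "(\<lambda>n. indicator {0<..<1} x *\<^sub>R (F' x * \<phi> n x))
          \<longlonglongrightarrow> indicator {0<..<1} x *\<^sub>R (F' x * indicator {a..b} x)"
        by (intro tendsto_intros)
    qed
  qed
  also have "(LINT x:{0<..<1}|lebesgue. F' x * indicator {a..b} x) = (LINT x:{a..b}|lebesgue. F' x)"
    unfolding set_lebesgue_integral_def
    using ab by (intro Bochner_Integration.integral_cong) (auto simp: indicator_def)
  finally have "(\<lambda>n. - (LINT x:{0<..<1}|lebesgue. F' x * \<phi> n x)) \<longlonglongrightarrow> - (LINT x:{a..b}|lebesgue. F' x)"
    by (rule tendsto_minus)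
  from LIMSEQ_unique[OF this lim2] show ?thesis by simp
qed

section \<open>The dual function of a concave flux\<close>

text \<open>On each cell k of a division the integral of f is nonnegative, so |k| |f x| exceeds it
  by at most the error of f on k. Henstock's lemma makes the sum of these errors small, so fine
  Riemann sums of |f| cannot exceed the integral of f by more than epsilon.\<close>

lemma integral_abs_eq_if_nonneg_subintegrals:
  fixes f :: "real \<Rightarrow> real"
  assumes f: "f absolutely_integrable_on {a..b}"
    and nonneg: "\<And>x y. a \<le> x \<Longrightarrow> x \<le> y \<Longrightarrow> y \<le> b \<Longrightarrow> 0 \<le> integral {x..y} f"
  shows "integral {a..b} (\<lambda>x. \<bar>f x\<bar>) = integral {a..b} f"
proof (rule antisym)
  have fi: "f integrable_on cbox a b" and afi: "(\<lambda>x. \<bar>f x\<bar>) integrable_on cbox a b"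
    using f by (auto simp: absolutely_integrable_on_def)
  show "integral {a..b} f \<le> integral {a..b} (\<lambda>x. \<bar>f x\<bar>)"
    using fi afi by (intro integral_le) auto
  show "integral {a..b} (\<lambda>x. \<bar>f x\<bar>) \<le> integral {a..b} f"
  proof (rule field_le_epsilon)
    fix e :: real assume "0 < e"
    then have e2: "e/2 > 0" by simp
    obtain \<gamma>1 where \<gamma>1: "gauge \<gamma>1" and
      H1: "\<And>p. \<lbrakk>p tagged_partial_division_of (cbox a b); \<gamma>1 fine p\<rbrakk> \<Longrightarrow>
             sum (\<lambda>(x,k). norm (measure lborel k *\<^sub>R f x - integral k f)) p < e/2"
      using Henstock_lemma[OF fi e2] by (metis (no_types, lifting))
    obtain \<gamma>2 where g2: "gauge \<gamma>2 \<and> (\<forall>p. p tagged_division_of (cbox a b) \<and> \<gamma>2 fine p \<longrightarrow>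
        norm ((\<Sum>(x,k)\<in>p. measure lborel k *\<^sub>R \<bar>f x\<bar>) - integral (cbox a b) (\<lambda>x. \<bar>f x\<bar>)) < e/2)"
      using integrable_integral[OF afi, unfolded has_integral, rule_format, OF e2] by (rule exE)
    then have \<gamma>2: "gauge \<gamma>2" by (rule conjunct1)
    \<comment> \<open>One division fine for both gauges serves Henstock's lemma for f and the
      Riemann sums of |f| at once.\<close>
    obtain p where p: "p tagged_division_of (cbox a b)" and fine: "(\<lambda>x. \<gamma>1 x \<inter> \<gamma>2 x) fine p"
      by (rule fine_division_exists[OF gauge_Int[OF \<gamma>1 \<gamma>2]])
    have "\<gamma>1 fine p" "\<gamma>2 fine p" using fine by (simp_all only: fine_Int)
    have "measure lborel k *\<^sub>R \<bar>f x\<bar> - integral k f \<le> norm (measure lborel k *\<^sub>R f x - integral k f)"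
      if xk: "(x, k) \<in> p" for x k
    proof -
      obtain u v where k: "k = cbox u v" using tagged_division_ofD(4)[OF p xk] by (elim exE)
      note tagged_division_ofD(2,3)[OF p xk]
      then have "0 \<le> integral k f"
        using nonneg[of u v] unfolding k by (simp add: atLeastatMost_subset_iff)
      moreover have "measure lborel k *\<^sub>R \<bar>f x\<bar> = \<bar>measure lborel k *\<^sub>R f x\<bar>"
        by (simp add: abs_mult)
      ultimately show ?thesis by simp
    qed
    then have "(\<Sum>(x,k)\<in>p. measure lborel k *\<^sub>R \<bar>f x\<bar> - integral k f)
        \<le> (\<Sum>(x,k)\<in>p. norm (measure lborel k *\<^sub>R f x - integral k f))"
      by (intro sum_mono) (simp only: split_paired_all prod.case)
    also have "\<dots> < e/2"
      using H1[OF p[unfolded tagged_division_of_def, THEN conjunct1] \<open>\<gamma>1 fine p\<close>]  by simp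
    finally have "(\<Sum>(x,k)\<in>p. measure lborel k *\<^sub>R \<bar>f x\<bar>) - (\<Sum>(x,k)\<in>p. integral k f) < e/2"
      by (simp add: case_prod_unfold sum_subtractf)
    moreover have "(\<Sum>(x,k)\<in>p. integral k f) = integral (cbox a b) f"
      using integral_combine_tagged_division_topdown[OF fi p] by simp
    moreover note g2[THEN conjunct2, rule_format, OF conjI, OF p \<open>\<gamma>2 fine p\<close>]
    ultimately show "integral {a..b} (\<lambda>x. \<bar>f x\<bar>) \<le> integral {a..b} f + e"
      by simp argo
  qed
qed

text \<open>The integrand (|p - w| - |w|)/2 of the dual function changes sign. Adding p/2 or -p/2,
  according to the sign of w, makes it nonnegative and thus fit for Tonelli; with p =
  \<open>f x\<close> the added term integrates to 0 because F vanishes at both end points.\<close>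

definition gap_kernel :: "real \<Rightarrow> real \<Rightarrow> real" where
  "gap_kernel p w = (if 0 \<le> w then max 0 (p - w) else max 0 (w - p))"

lemma gap_kernel_nonneg: "0 \<le> gap_kernel p w"
  by (simp add: gap_kernel_def)

lemma gap_kernel_eq: "gap_kernel p w = (\<bar>p - w\<bar> - \<bar>w\<bar> + (if 0 \<le> w then p else - p)) / 2"
  by (auto simp: gap_kernel_def max_def abs_if)

lemma borel_measurable_gap_kernel [measurable (raw)]:
  assumes [measurable]: "p \<in> borel_measurable M" "q \<in> borel_measurable M"
  shows "(\<lambda>x. gap_kernel (p x) (q x)) \<in> borel_measurable M"
  unfolding gap_kernel_def by measurable

text \<open>As a function of w the kernel bounds a right triangle over the interval between 0 and p,
  with both legs of length |p|.\<close>

lemma nn_integral_gap_kernel: "(\<integral>\<^sup>+ w. ennreal (gap_kernel p w) \<partial>lborel) = ennreal (p\<^sup>2 / 2)"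
proof (cases "0 \<le> p")
  case True
  have "(\<integral>\<^sup>+ w. ennreal (gap_kernel p w) \<partial>lborel)
      = (\<integral>\<^sup>+ w. ennreal (p - w) * indicator {0..p} w \<partial>lborel)"
    using True by (intro nn_integral_cong) (auto simp: gap_kernel_def indicator_def max_def)
  also have "\<dots> = ennreal ((p * p - p\<^sup>2 / 2) - (p * 0 - 0\<^sup>2 / 2))"
    using True
    by (intro nn_integral_FTC_Icc)
       (auto intro!: derivative_eq_intros simp flip: has_real_derivative_iff_has_vector_derivative)
  finally show ?thesis by (simp add: power2_eq_square)
next
  case False
  \<comment> \<open>For p < 0 the two integrands differ at w = 0, where the kernel takes its branch
    for \<open>0 \<le> w\<close> and vanishes.\<close>
  have "AE w in lborel. w \<noteq> (0::real)" by (rule AE_lborel_singleton)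
  then have "(\<integral>\<^sup>+ w. ennreal (gap_kernel p w) \<partial>lborel)
      = (\<integral>\<^sup>+ w. ennreal (w - p) * indicator {p..0} w \<partial>lborel)"
    using False
    by (intro nn_integral_cong_AE) (auto simp: gap_kernel_def indicator_def max_def elim!: eventually_mono)
  also have "\<dots> = ennreal ((0\<^sup>2 / 2 - p * 0) - (p\<^sup>2 / 2 - p * p))"
    using False
    by (intro nn_integral_FTC_Icc)
       (auto intro!: derivative_eq_intros simp flip: has_real_derivative_iff_has_vector_derivative)
  finally show ?thesis by (simp add: power2_eq_square)
qed

text \<open>The Sobolev hypothesis in the form in which it is used: \<open>f\<close> is a Borel
  representative of the derivative, so that Tonelli applies over \<open>lborel\<close>, and the
  increment formula includes the end points 0 and 1.\<close>

locale concave_flux =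
  fixes F f :: "real \<Rightarrow> real"
  assumes concave: "concave_on {0..1} F"
    and F0: "F 0 = 0" and F1: "F 1 = 0"
    and f_borel [measurable]: "f \<in> borel_measurable borel"
    and f_abs: "f absolutely_integrable_on {0..1}"
    and f_sq: "set_integrable lborel {0..1} (\<lambda>x. (f x)\<^sup>2)"
    and f_integral: "\<And>x y. 0 \<le> x \<Longrightarrow> x \<le> y \<Longrightarrow> y \<le> 1 \<Longrightarrow> integral {x..y} f = F y - F x"
begin

definition energy :: real where
  "energy = (LINT x:{0..1}|lborel. (f x)\<^sup>2)"

text \<open>This is the function \<psi> of the overview. Its integral form, rather than the maximum
  over states, gives access to measurability and Tonelli; \<open>dual_bound\<close> and
  \<open>dual_eq_iff\<close> recover the maximum.\<close>

definition dual :: "real \<Rightarrow> real" where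
  "dual w = (integral {0..1} (\<lambda>x. \<bar>f x - w\<bar>) - \<bar>w\<bar>) / 2"

section \<open>The dual function as a maximum over states, attained at supergradients\<close>

lemma shift_abs: "(\<lambda>x. f x - w) absolutely_integrable_on {0..1}"
  using f_abs by (intro set_integral_diff(1)) (auto simp: absolutely_integrable_on_def)

lemma shift_abs_sub:
  "0 \<le> x \<Longrightarrow> y \<le> 1 \<Longrightarrow> (\<lambda>x. f x - w) absolutely_integrable_on {x..y}"
  by (rule set_integrable_subset[OF shift_abs]) auto

lemma shift_integral:
  assumes "0 \<le> x" "x \<le> y" "y \<le> 1"
  shows "integral {x..y} (\<lambda>t. f t - w) = (F y - w * y) - (F x - w * x)"
proof -
  have "f integrable_on {x..y}"
    using set_integrable_subset[OF f_abs, of "{x..y}"] assms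
    by (auto simp: absolutely_integrable_on_def)
  then show ?thesis
    using assms by (subst Henstock_Kurzweil_Integration.integral_diff) (auto simp: f_integral algebra_simps)
qed

lemma F_nonneg: "x \<in> {0..1} \<Longrightarrow> 0 \<le> F x"
  using concave_onD[OF concave, of x 0 1] by (auto simp: F0 F1)

lemma stratified_divide: "0 < \<tau> \<Longrightarrow> stratified (z / \<tau>) = stratified z"
  by (auto simp: stratified_def divide_simps)

text \<open>A supergradient w at \<sigma> makes \<sigma> a maximum point of the concave function F -
  w id, which therefore increases up to \<sigma>. The proof writes y as a convex combination of x
  and \<sigma>.\<close>

lemma superdiff_mono_left:
  assumes "w \<in> superdiff F \<sigma>" "\<sigma> \<in> {0..1}" "0 \<le> x" "x \<le> y" "y \<le> \<sigma>"
  shows "F x - w * x \<le> F y - w * y"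
proof (cases "x = \<sigma>")
  case False
  define t where "t = (y - x) / (\<sigma> - x)"
  have t: "0 \<le> t" "t \<le> 1" "t * (\<sigma> - x) = y - x"
    using assms False by (auto simp: t_def)
  have y: "(1 - t) *\<^sub>R x + t *\<^sub>R \<sigma> = y" using t by (simp add: algebra_simps)
  have "(1 - t) * F x + t * F \<sigma> \<le> F y"
    using concave_onD[OF concave, of t x \<sigma>] t(1,2) assms unfolding y by auto
  moreover have "F x \<le> F \<sigma> + w * (x - \<sigma>)"
    using assms by (auto simp: superdiff_def)
  then have "t * F x \<le> t * (F \<sigma> + w * (x - \<sigma>))"
    using t by (intro mult_left_mono) auto
  then have "t * F x \<le> t * F \<sigma> - w * (t * (\<sigma> - x))" by (simp add: algebra_simps)
  ultimately show ?thesis unfolding t(3) by (simp add: algebra_simps)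
qed (use assms in auto)

lemma superdiff_mono_right:
  assumes "w \<in> superdiff F \<sigma>" "\<sigma> \<in> {0..1}" "\<sigma> \<le> x" "x \<le> y" "y \<le> 1"
  shows "F y - w * y \<le> F x - w * x"
proof (cases "y = \<sigma>")
  case False
  define t where "t = (y - x) / (y - \<sigma>)"
  have t: "0 \<le> t" "t \<le> 1" "t * (y - \<sigma>) = y - x"
    using assms False by (auto simp: t_def)
  have y: "(1 - t) *\<^sub>R y + t *\<^sub>R \<sigma> = x" using t by (simp add: algebra_simps)
  have "(1 - t) * F y + t * F \<sigma> \<le> F x"
    using concave_onD[OF concave, of t y \<sigma>] t(1,2) assms unfolding y by auto
  moreover have "F y \<le> F \<sigma> + w * (y - \<sigma>)"
    using assms by (auto simp: superdiff_def)
  then have "t * F y \<le> t * (F \<sigma> + w * (y - \<sigma>))"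
    using t by (intro mult_left_mono) auto
  then have "t * F y \<le> t * F \<sigma> + w * (t * (y - \<sigma>))" by (simp add: algebra_simps)
  ultimately show ?thesis unfolding t(3) by (simp add: algebra_simps)
qed (use assms in auto)

lemma abs_integral_combine:
  assumes "\<sigma> \<in> {0..1}"
  shows "integral {0..1} (\<lambda>x. \<bar>f x - w\<bar>)
    = integral {0..\<sigma>} (\<lambda>x. \<bar>f x - w\<bar>) + integral {\<sigma>..1} (\<lambda>x. \<bar>f x - w\<bar>)"
  using assms shift_abs[of w]
  by (intro Henstock_Kurzweil_Integration.integral_combine[symmetric])
     (auto simp: absolutely_integrable_on_def)

text \<open>Since F vanishes at 0 and 1, the two integrals add up to the left-hand side except for
  the term (w - |w|)/2, which is \<open>stratified w * w\<close>. This is how the stratified profile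
  enters.\<close>

lemma gap_eq:
  assumes "\<sigma> \<in> {0..1}"
  shows "F \<sigma> - (\<sigma> - stratified w) * w
    = (integral {0..\<sigma>} (\<lambda>x. f x - w) - integral {\<sigma>..1} (\<lambda>x. f x - w) - \<bar>w\<bar>) / 2"
  using assms by (auto simp: shift_integral F0 F1 stratified_def algebra_simps)

text \<open>By \<open>gap_eq\<close> the left-hand side has signed integrals over the two halves of
  the interval where \<open>dual\<close> has integrals of absolute values.\<close>

lemma dual_bound:
  assumes \<sigma>: "\<sigma> \<in> {0..1}"
  shows "F \<sigma> - (\<sigma> - stratified w) * w \<le> dual w"
proof -
  have "\<bar>integral {x..y} (\<lambda>x. f x - w)\<bar> \<le> integral {x..y} (\<lambda>x. \<bar>f x - w\<bar>)"
    if "0 \<le> x" "y \<le> 1" for x y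
    using integral_norm_bound_integral[of "\<lambda>x. f x - w" "{x..y}" "\<lambda>x. \<bar>f x - w\<bar>"]
      shift_abs_sub[OF that] by (auto simp: absolutely_integrable_on_def)
  from this[of 0 \<sigma>] this[of \<sigma> 1] show ?thesis
    unfolding gap_eq[OF \<sigma>] dual_def abs_integral_combine[OF \<sigma>] using \<sigma> by auto
qed

text \<open>If equality holds, \<open>dual_bound\<close> makes \<sigma> a maximum point of F - w id.
  Conversely, at such a point the subintegrals of f - w are nonnegative to the left of \<sigma> and
  nonpositive to the right, so the triangle inequalities behind \<open>dual_bound\<close> lose
  nothing.\<close>

lemma dual_eq_iff:
  assumes \<sigma>: "\<sigma> \<in> {0..1}"
  shows "F \<sigma> - (\<sigma> - stratified w) * w = dual w \<longleftrightarrow> w \<in> superdiff F \<sigma>"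
proof
  assume eq: "F \<sigma> - (\<sigma> - stratified w) * w = dual w"
  show "w \<in> superdiff F \<sigma>"
    unfolding superdiff_def
  proof (intro CollectI ballI)
    fix y :: real assume "y \<in> {0..1}"
    from dual_bound[OF this, of w] eq show "F y \<le> F \<sigma> + w * (y - \<sigma>)"
      by (simp add: algebra_simps)
  qed
next
  assume w: "w \<in> superdiff F \<sigma>"
  have "integral {0..\<sigma>} (\<lambda>x. \<bar>f x - w\<bar>) = integral {0..\<sigma>} (\<lambda>x. f x - w)"
    using \<sigma> superdiff_mono_left[OF w \<sigma>]
    by (intro integral_abs_eq_if_nonneg_subintegrals shift_abs_sub) (auto simp: shift_integral)
  moreover have "integral {\<sigma>..1} (\<lambda>x. \<bar>w - f x\<bar>) = integral {\<sigma>..1} (\<lambda>x. w - f x)"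
  proof (rule integral_abs_eq_if_nonneg_subintegrals)
    show "(\<lambda>x. w - f x) absolutely_integrable_on {\<sigma>..1}"
      using set_integrable_mult_right[of "-1::real", OF shift_abs_sub[of \<sigma> 1 w]] \<sigma> by simp
    fix x y :: real assume xy: "\<sigma> \<le> x" "x \<le> y" "y \<le> 1"
    have "integral {x..y} (\<lambda>x. w - f x) = - integral {x..y} (\<lambda>x. f x - w)"
      by (subst integral_neg[symmetric]) simp
    then show "0 \<le> integral {x..y} (\<lambda>x. w - f x)"
      using xy \<sigma> superdiff_mono_right[OF w \<sigma> xy] by (simp add: shift_integral)
  qed
  moreover have "integral {\<sigma>..1} (\<lambda>x. w - f x) = - integral {\<sigma>..1} (\<lambda>x. f x - w)"
    by (subst integral_neg[symmetric]) simp
  ultimately show "F \<sigma> - (\<sigma> - stratified w) * w = dual w"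
    unfolding gap_eq[OF \<sigma>] dual_def abs_integral_combine[OF \<sigma>]
    by (simp add: abs_minus_commute)
qed

section \<open>The integral of the dual function\<close>

lemma ennreal_dual:
  "ennreal (dual w) = (\<integral>\<^sup>+ x. ennreal (gap_kernel (f x) w) * indicator {0..1} x \<partial>lborel)"
  and dual_nonneg: "0 \<le> dual w"
proof -
  let ?g = "\<lambda>x. gap_kernel (f x) w"
  have "(\<lambda>x. if 0 \<le> w then f x else - f x) absolutely_integrable_on {0..1}"
    using f_abs set_integrable_mult_right[of "-1::real", OF f_abs] by (cases "0 \<le> w") auto
  then have g: "?g absolutely_integrable_on {0..1}"
    unfolding gap_kernel_eq
    by (intro set_integral_diff(1) set_integral_add(1) set_integrable_divide set_integrable_abs shift_abs)
       (auto simp: absolutely_integrable_on_def)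
  have "integral {0..1} ?g = dual w"
  proof -
    have i: "f integrable_on {0..1}" "(\<lambda>x. \<bar>f x - w\<bar>) integrable_on {0..1}"
      using f_abs shift_abs[of w] by (auto simp: absolutely_integrable_on_def)
    \<comment> \<open>The correction that makes the kernel nonnegative has mean zero, as F 0 = F
      1.\<close>
    have "((\<lambda>x. if 0 \<le> w then f x else - f x) has_integral 0) {0..1}"
      using f_integral[of 0 1] integrable_integral[OF i(1)] has_integral_neg[of f 0 "{0..1}"]
      by (cases "0 \<le> w") (auto simp: F0 F1)
    then have "((\<lambda>x. \<bar>f x - w\<bar> - \<bar>w\<bar> + (if 0 \<le> w then f x else - f x))
      has_integral (integral {0..1} (\<lambda>x. \<bar>f x - w\<bar>) - \<bar>w\<bar> + 0)) {0..1}"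
      using integrable_integral[OF i(2)] has_integral_const_real[of "\<bar>w\<bar>" 0 1]
      by (intro has_integral_add has_integral_diff) auto
    then show ?thesis
      unfolding gap_kernel_eq dual_def by (simp add: integral_unique)
  qed
  moreover have "(LINT x:{0..1}|lborel. ?g x) = integral {0..1} ?g"
    and gi: "set_integrable lborel {0..1} ?g"
  proof -
    have "integrable lebesgue (\<lambda>x. indicator {0..1} x *\<^sub>R ?g x)"
      using g by (simp add: set_integrable_def)
    then show "set_integrable lborel {0..1} ?g"
      unfolding set_integrable_def by (subst integrable_completion[symmetric]) auto
    then show "(LINT x:{0..1}|lborel. ?g x) = integral {0..1} ?g"
      by (rule set_borel_integral_eq_integral)
  qed
  ultimately have eq: "dual w = (LINT x:{0..1}|lborel. ?g x)" by simp
  show "0 \<le> dual w"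
    unfolding eq set_lebesgue_integral_def
    by (intro Bochner_Integration.integral_nonneg) (auto simp: gap_kernel_nonneg)
  show "ennreal (dual w) = (\<integral>\<^sup>+ x. ennreal (?g x) * indicator {0..1} x \<partial>lborel)"
    unfolding eq set_lebesgue_integral_def
    using gi unfolding set_integrable_def
    by (subst nn_integral_eq_integral[symmetric])
       (auto simp: gap_kernel_nonneg indicator_def intro!: nn_integral_cong)
qed

lemma dual_measurable [measurable]: "dual \<in> borel_measurable borel"
proof -
  have "(\<lambda>w. enn2real (\<integral>\<^sup>+ x. ennreal (gap_kernel (f x) w) * indicator {0..1} x \<partial>lborel))
      \<in> borel_measurable borel"
    by (intro borel_measurable_enn2real lborel.borel_measurable_nn_integral)
      (auto intro!: borel_measurable_times)
  then show ?thesis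
    unfolding ennreal_dual[symmetric] by (simp add: dual_nonneg)
qed

lemma energy_nonneg: "0 \<le> energy"
  unfolding energy_def set_lebesgue_integral_def by (intro Bochner_Integration.integral_nonneg) auto

lemma nn_integral_dual: "(\<integral>\<^sup>+ w. ennreal (dual w) \<partial>lborel) = ennreal (energy / 2)"
proof -
  have "(\<integral>\<^sup>+ w. ennreal (dual w) \<partial>lborel)
      = (\<integral>\<^sup>+ w. \<integral>\<^sup>+ x. ennreal (gap_kernel (f x) w) * indicator {0..1} x \<partial>lborel \<partial>lborel)"
    by (simp add: ennreal_dual)
  also have "\<dots> = (\<integral>\<^sup>+ x. \<integral>\<^sup>+ w. ennreal (gap_kernel (f x) w) * indicator {0..1} x \<partial>lborel \<partial>lborel)"
    by (rule lborel_pair.Fubini') (auto intro!: borel_measurable_times)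
  also have "\<dots> = (\<integral>\<^sup>+ x. ennreal ((f x)\<^sup>2 / 2) * indicator {0..1} x \<partial>lborel)"
  proof (intro nn_integral_cong)
    fix x
    show "(\<integral>\<^sup>+ w. ennreal (gap_kernel (f x) w) * indicator {0..1} x \<partial>lborel)
        = ennreal ((f x)\<^sup>2 / 2) * indicator {0..1} x"
      by (subst nn_integral_multc) (auto simp: nn_integral_gap_kernel)
  qed
  also have "\<dots> = (\<integral>\<^sup>+ x. ennreal (indicator {0..1} x *\<^sub>R ((f x)\<^sup>2 / 2)) \<partial>lborel)"
    by (intro nn_integral_cong) (auto simp: indicator_def)
  also have "\<dots> = ennreal (LINT x:{0..1}|lborel. (f x)\<^sup>2 / 2)"
    unfolding set_lebesgue_integral_def
    using set_integrable_divide[OF f_sq, of 2] unfolding set_integrable_def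
    by (intro nn_integral_eq_integral) auto
  finally show ?thesis by (simp add: energy_def)
qed

text \<open>One factor \<tau> is the prefactor and the other comes from the substitution of \<tau> z
  for z.\<close>

lemma nn_integral_scaled_dual:
  assumes "0 < \<tau>"
  shows "(\<integral>\<^sup>+ z. ennreal (\<tau> * dual (z / \<tau>)) \<partial>lebesgue) = ennreal (\<tau>\<^sup>2 * energy / 2)"
proof -
  have "(\<integral>\<^sup>+ z. ennreal (\<tau> * dual (z / \<tau>)) \<partial>lborel)
      = ennreal \<bar>\<tau>\<bar> * (\<integral>\<^sup>+ z. ennreal (\<tau> * dual ((0 + \<tau> * z) / \<tau>)) \<partial>lborel)"
    using assms by (intro nn_integral_real_affine) auto
  also have "\<dots> = ennreal \<tau> * (\<integral>\<^sup>+ z. ennreal \<tau> * ennreal (dual z) \<partial>lborel)"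
    using assms by (simp add: ennreal_mult dual_nonneg)
  also have "\<dots> = ennreal (\<tau>\<^sup>2 * energy / 2)"
    using assms energy_nonneg
    by (simp add: nn_integral_cmult nn_integral_dual ennreal_mult[symmetric] power2_eq_square mult.assoc)
  finally show ?thesis by (simp add: nn_integral_completion)
qed

lemma F_continuous: "continuous_on {0..1} F"
proof -
  have "f integrable_on {0..1}" using f_abs by (simp add: absolutely_integrable_on_def)
  then have "continuous_on {0..1} (\<lambda>x. integral {0..x} f)"
    by (rule indefinite_integral_continuous_1)
  then show ?thesis
    by (rule continuous_on_eq) (simp add: f_integral F0)
qed

lemma F_comp_measurable:
  assumes "s \<in> borel_measurable M" "\<And>z. s z \<in> {0..1}"
  shows "(\<lambda>z. F (s z)) \<in> borel_measurable M"
proof -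
  \<comment> \<open>Clamping the argument extends F continuously to the line and leaves the values F
    (s z) unchanged.\<close>
  have "continuous_on UNIV (\<lambda>x. F (max 0 (min 1 x)))"
    by (intro continuous_on_compose2[OF F_continuous] continuous_intros) auto
  then have "(\<lambda>x. F (max 0 (min 1 x))) \<in> borel_measurable borel"
    by (rule borel_measurable_continuous_onI)
  from measurable_compose[OF assms(1) this] show ?thesis
    using assms(2) by simp
qed

section \<open>Young's inequality, pointwise and integrated\<close>

lemma stratified_measurable [measurable]: "stratified \<in> borel_measurable borel"
  unfolding stratified_def[abs_def] by measurable

lemma moment_nonneg: "x \<in> {0..1} \<Longrightarrow> 0 \<le> (x - stratified z) * z"
  by (auto simp: stratified_def mult_nonneg_nonneg mult_nonpos_nonpos)

text \<open>These are \<open>dual_bound\<close> and \<open>dual_eq_iff\<close> at w = z/\<tau>,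
  multiplied by \<tau>; a positive dilation does not change \<open>stratified\<close>.\<close>

lemma young_pointwise:
  assumes "x \<in> {0..1}" "0 < \<tau>"
  shows "\<tau> * F (x) \<le> (x - stratified z) * z + \<tau> * dual (z / \<tau>)"
    and "\<tau> * F (x) = (x - stratified z) * z + \<tau> * dual (z / \<tau>) \<longleftrightarrow> z / \<tau> \<in> superdiff F (x)"
proof -
  have eq: "\<tau> * (F (x) - (x - stratified (z / \<tau>)) * (z / \<tau>))
      = \<tau> * F (x) - (x - stratified z) * z"
    using assms(2) by (simp add: stratified_divide algebra_simps)
  have "\<tau> * (F (x) - (x - stratified (z / \<tau>)) * (z / \<tau>)) \<le> \<tau> * dual (z / \<tau>)"
    using dual_bound[OF assms(1), of "z / \<tau>"] assms(2) by (intro mult_left_mono) simp_all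
  then show "\<tau> * F (x) \<le> (x - stratified z) * z + \<tau> * dual (z / \<tau>)"
    unfolding eq by simp
  have "\<tau> * (F (x) - (x - stratified (z / \<tau>)) * (z / \<tau>)) = \<tau> * dual (z / \<tau>)
      \<longleftrightarrow> z / \<tau> \<in> superdiff F (x)"
    using dual_eq_iff[OF assms(1), of "z / \<tau>"] assms(2) by simp
  then show "\<tau> * F (x) = (x - stratified z) * z + \<tau> * dual (z / \<tau>) \<longleftrightarrow> z / \<tau> \<in> superdiff F (x)"
    unfolding eq by (simp add: algebra_simps)
qed

lemma nn_integral_young:
  assumes "profile s" "0 < \<tau>"
  shows "(\<integral>\<^sup>+ z. ennreal (\<tau> * F (s z)) \<partial>lebesgue) = ennreal \<tau> * flux_integral F s"
    and "(\<integral>\<^sup>+ z. ennreal ((s z - stratified z) * z + \<tau> * dual (z / \<tau>)) \<partial>lebesgue)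
      = moment_integral s + ennreal (\<tau>\<^sup>2 * energy / 2)"
proof -
  have [measurable]: "s \<in> borel_measurable lebesgue" and s: "\<And>z. s z \<in> {0..1}"
    using assms(1) by (auto simp: profile_def)
  have [measurable]: "(\<lambda>z. F (s z)) \<in> borel_measurable lebesgue"
    by (rule F_comp_measurable) (use s in auto)
  show "(\<integral>\<^sup>+ z. ennreal (\<tau> * F (s z)) \<partial>lebesgue) = ennreal \<tau> * flux_integral F s"
    using assms(2) F_nonneg[OF s] by (simp add: flux_integral_def ennreal_mult nn_integral_cmult)
  have [measurable]: "(\<lambda>z::real. z) \<in> borel_measurable lebesgue" "dual \<in> borel_measurable borel"
    "(\<lambda>z. \<tau> * dual (z / \<tau>)) \<in> borel_measurable lebesgue"
    "stratified \<in> borel_measurable lebesgue"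
    by (auto intro!: measurable_completion)
  have "(\<integral>\<^sup>+ z. ennreal ((s z - stratified z) * z + \<tau> * dual (z / \<tau>)) \<partial>lebesgue)
      = (\<integral>\<^sup>+ z. ennreal ((s z - stratified z) * z) + ennreal (\<tau> * dual (z / \<tau>)) \<partial>lebesgue)"
    using moment_nonneg[OF s] assms(2)
    by (intro nn_integral_cong ennreal_plus) (auto simp: dual_nonneg)
  also have "\<dots> = moment_integral s + (\<integral>\<^sup>+ z. ennreal (\<tau> * dual (z / \<tau>)) \<partial>lebesgue)"
    unfolding moment_integral_def by (intro nn_integral_add) measurable
  finally show "(\<integral>\<^sup>+ z. ennreal ((s z - stratified z) * z + \<tau> * dual (z / \<tau>)) \<partial>lebesgue)
      = moment_integral s + ennreal (\<tau>\<^sup>2 * energy / 2)"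
    using assms(2) by (simp add: nn_integral_scaled_dual)
qed

lemma young_integrated:
  assumes "profile s" "0 < \<tau>"
  shows "ennreal \<tau> * flux_integral F s \<le> moment_integral s + ennreal (\<tau>\<^sup>2 * energy / 2)"
  unfolding nn_integral_young[OF assms, symmetric]
  using young_pointwise(1) assms by (intro nn_integral_mono ennreal_leI) (auto simp: profile_def)

lemma young_integrated_eq:
  assumes "profile s" "0 < \<tau>" "AE z in lebesgue. z / \<tau> \<in> superdiff F (s z)"
  shows "ennreal \<tau> * flux_integral F s = moment_integral s + ennreal (\<tau>\<^sup>2 * energy / 2)"
  unfolding nn_integral_young[OF assms(1,2), symmetric]
proof (rule nn_integral_cong_AE)
  have "s z \<in> {0..1}" for z using assms(1) by (auto simp: profile_def)
  then show "AE z in lebesgue. ennreal (\<tau> * F (s z))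
      = ennreal ((s z - stratified z) * z + \<tau> * dual (z / \<tau>))"
    using assms(3) young_pointwise(2) assms(2) by (auto elim!: eventually_mono intro!: arg_cong[where f = ennreal])
qed

text \<open>A finite moment allows the two integrals to be subtracted. The slack in the pointwise
  inequality is nonnegative and has integral zero, so it vanishes almost everywhere and the
  pointwise equality case applies.\<close>

lemma young_integrated_eqD:
  assumes s: "profile s" and \<tau>: "0 < \<tau>" and fin: "moment_integral s < \<infinity>"
    and eq: "ennreal \<tau> * flux_integral F s = moment_integral s + ennreal (\<tau>\<^sup>2 * energy / 2)"
  shows "AE z in lebesgue. z / \<tau> \<in> superdiff F (s z)"
proof -
  have [measurable]: "s \<in> borel_measurable lebesgue" and s01: "\<And>z. s z \<in> {0..1}"
    using s by (auto simp: profile_def)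
  have [measurable]: "(\<lambda>z. F (s z)) \<in> borel_measurable lebesgue"
    by (rule F_comp_measurable) (use s01 in auto)
  have [measurable]: "(\<lambda>z::real. z) \<in> borel_measurable lebesgue" "dual \<in> borel_measurable borel"
    "(\<lambda>z. \<tau> * dual (z / \<tau>)) \<in> borel_measurable lebesgue"
    "stratified \<in> borel_measurable lebesgue"
    by (auto intro!: measurable_completion)
  let ?l = "\<lambda>z. ennreal (\<tau> * F (s z))"
  let ?r = "\<lambda>z. ennreal ((s z - stratified z) * z + \<tau> * dual (z / \<tau>))"
  have le: "?l z \<le> ?r z" for z
    using young_pointwise(1)[OF s01 \<tau>] by (intro ennreal_leI)
  have [measurable]: "?l \<in> borel_measurable lebesgue" "?r \<in> borel_measurable lebesgue"
    by measurable
  have "integral\<^sup>N lebesgue ?l = integral\<^sup>N lebesgue ?r"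
    unfolding nn_integral_young[OF s \<tau>] by (rule eq)
  moreover have "integral\<^sup>N lebesgue ?r < \<infinity>"
    unfolding nn_integral_young[OF s \<tau>] using fin by simp
  ultimately have "(\<integral>\<^sup>+ z. ?r z - ?l z \<partial>lebesgue) = 0"
    by (subst nn_integral_diff) (auto simp: le)
  then have "AE z in lebesgue. ?r z - ?l z = 0"
    by (subst (asm) nn_integral_0_iff_AE) auto
  then show ?thesis
  proof eventually_elim
    fix z assume "?r z - ?l z = 0"
    then have "?r z \<le> ?l z" by (metis diff_eq_0_iff_ennreal leI)
    \<comment> \<open>With this sign the inequality between \<open>ennreal\<close> values carries
      over to the reals.\<close>
    moreover have "0 \<le> \<tau> * F (s z)" using \<tau> F_nonneg[OF s01] by simp
    ultimately have "(s z - stratified z) * z + \<tau> * dual (z / \<tau>) \<le> \<tau> * F (s z)"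
      by (simp add: ennreal_le_iff)
    then show "z / \<tau> \<in> superdiff F (s z)"
      using young_pointwise[OF s01 \<tau>] by (metis antisym)
  qed
qed

end

section \<open>Sharpness and rarefaction profiles\<close>

lemma flux_integral_cong_AE:
  "AE z in lebesgue. s z = r z \<Longrightarrow> flux_integral F s = flux_integral F r"
  unfolding flux_integral_def by (rule nn_integral_cong_AE) (auto elim!: eventually_mono)

lemma moment_integral_cong_AE:
  "AE z in lebesgue. s z = r z \<Longrightarrow> moment_integral s = moment_integral r"
  unfolding moment_integral_def by (rule nn_integral_cong_AE) (auto elim!: eventually_mono)

lemma quadratic_bound_imp_le_sqrt:
  fixes a m q :: real
  assumes "0 \<le> a" "0 \<le> m" "0 \<le> q" and le: "\<And>\<tau>. 0 < \<tau> \<Longrightarrow> \<tau> * a \<le> m + \<tau>\<^sup>2 * q / 2"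
  shows "a \<le> sqrt (2 * q) * sqrt m"
proof -
  have "a\<^sup>2 \<le> 2 * q * m"
  proof (cases "a = 0")
    case False
    then have a: "0 < a" using assms by simp
    show ?thesis
    proof (cases "q = 0")
      case True
      \<comment> \<open>For q = 0 the assumption bounds a linear function of \<tau>; this \<tau>
        turns it into m + 1 \<le> m.\<close>
      have "(m + 1) / a * a \<le> m"
        using le[of "(m + 1) / a"] a \<open>0 \<le> m\<close> True by simp
      then show ?thesis using a by simp
    next
      case False
      then have q: "0 < q" using assms by simp
      show ?thesis
        \<comment> \<open>The choice a/q minimises m + \<tau>^2 q/2 - \<tau> a.\<close>
        using le[of "a / q"] a q by (simp add: field_simps power2_eq_square)
    qed
  qed (use assms in auto)
  then have "a \<le> sqrt (2 * q * m)"
    by (rule real_le_rsqrt)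
  then show ?thesis by (simp add: real_sqrt_mult)
qed

lemma antimono_borel_measurable:
  fixes r :: "real \<Rightarrow> real"
  assumes "antimono r"
  shows "r \<in> borel_measurable borel"
proof -
  have "(\<lambda>x. - r x) \<in> borel_measurable borel"
    using assms by (intro borel_measurable_mono monoI) (auto dest: antimonoD)
  from borel_measurable_uminus[OF this] show ?thesis by simp
qed

section \<open>Existence of rarefaction profiles and correction on null sets\<close>

context concave_flux
begin

text \<open>Adding the two supergradient inequalities gives 0 \<le> (q - p)(x - y).\<close>

lemma superdiff_antimono:
  assumes "p \<in> superdiff F x" "q \<in> superdiff F y" "x \<in> {0..1}" "y \<in> {0..1}" "p < q"
  shows "y \<le> x"
proof -
  have "F y \<le> F x + p * (y - x)" "F x \<le> F y + q * (x - y)"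
    using assms by (auto simp: superdiff_def)
  then have "0 \<le> (q - p) * (x - y)" by (simp add: algebra_simps)
  then show ?thesis using \<open>p < q\<close> by (simp add: zero_le_mult_iff)
qed

text \<open>A maximum point of the continuous function F - w id on the compact interval has w as a
  supergradient.\<close>

lemma superdiff_selection:
  obtains x where "x \<in> {0..1}" "w \<in> superdiff F x"
proof -
  have "\<exists>x\<in>{0..1}. \<forall>y\<in>{0..1}. F y - w * y \<le> F x - w * x"
    by (intro continuous_attains_sup continuous_intros F_continuous) auto
  then obtain x where "x \<in> {0..1}" and *: "\<And>y. y \<in> {0..1} \<Longrightarrow> F y - w * y \<le> F x - w * x"
    by blast
  moreover have "F y \<le> F x + w * (y - x)" if "y \<in> {0..1}" for y
    using *[OF that] by (simp add: algebra_simps)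
  ultimately show ?thesis
    by (intro that[of x]) (auto simp: superdiff_def)
qed

text \<open>Monotonicity of supergradients makes r antitone, hence measurable. Testing the
  supergradient inequality at the states 0 and 1 bounds r and 1 - r by a multiple of 1/|z|, which
  gives both limits.\<close>

lemma profile_if_superdiff:
  assumes \<tau>: "0 < \<tau>" and r: "\<And>z. r z \<in> {0..1}" and sd: "\<And>z. z / \<tau> \<in> superdiff F (r z)"
  shows "profile r"
proof -
  have "antimono r"
  proof (rule antimonoI)
    fix y z :: real assume "y \<le> z"
    then show "r z \<le> r y"
      using superdiff_antimono[OF sd[of y] sd[of z] r r] \<tau>
      by (cases "y = z") (auto simp: divide_strict_right_mono)
  qed
  then have "r \<in> borel_measurable lebesgue"
    by (intro measurable_completion) (simp add: antimono_borel_measurable)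
  obtain c where c: "c \<in> {0..1}" "\<And>y. y \<in> {0..1} \<Longrightarrow> F y \<le> F c"
    using continuous_attains_sup[OF compact_Icc _ F_continuous] by auto
  define B where "B = \<tau> * F c"
  have lower: "z * r z \<le> B" for z
  proof -
    have "F 0 \<le> F (r z) + z / \<tau> * (0 - r z)"
      using sd[of z] unfolding superdiff_def mem_Collect_eq by (rule bspec) simp
    then have "z / \<tau> * r z \<le> F c" using c(2)[OF r[of z]] by (simp add: F0)
    then show ?thesis using \<tau> by (simp add: B_def field_simps)
  qed
  have upper: "- z * (1 - r z) \<le> B" for z
  proof -
    have "F 1 \<le> F (r z) + z / \<tau> * (1 - r z)"
      using sd[of z] unfolding superdiff_def mem_Collect_eq by (rule bspec) simp
    then have "- z / \<tau> * (1 - r z) \<le> F c" using c(2)[OF r[of z]] by (simp add: F1)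
    then show ?thesis using \<tau> by (simp add: B_def field_simps)
  qed
  have "(r \<longlongrightarrow> 0) at_top"
  proof (rule tendsto_sandwich)
    show "\<forall>\<^sub>F z in at_top. 0 \<le> r z" using r by auto
    show "\<forall>\<^sub>F z in at_top. r z \<le> B / z"
      using eventually_gt_at_top[of 0]
      by eventually_elim (use lower in \<open>simp add: field_simps\<close>)
    show "((\<lambda>z. B / z) \<longlongrightarrow> 0) at_top"
      by (intro tendsto_divide_0[OF tendsto_const] filterlim_at_top_imp_at_infinity filterlim_ident)
  qed auto
  moreover have "(r \<longlongrightarrow> 1) at_bot"
  proof (rule tendsto_sandwich)
    show "\<forall>\<^sub>F z in at_bot. r z \<le> 1" using r by auto
    show "\<forall>\<^sub>F z in at_bot. 1 + B / z \<le> r z"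
      using eventually_gt_at_bot[of 0]
      by eventually_elim (use upper in \<open>simp add: field_simps\<close>)
    have "((\<lambda>z. B / z) \<longlongrightarrow> 0) at_bot"
      by (intro tendsto_divide_0[OF tendsto_const] filterlim_at_bot_imp_at_infinity filterlim_ident)
    from tendsto_add[OF tendsto_const[of 1] this]
    show "((\<lambda>z. 1 + B / z) \<longlongrightarrow> 1) at_bot" by simp
  qed auto
  ultimately show ?thesis
    using r \<open>r \<in> borel_measurable lebesgue\<close> by (simp add: profile_def)
qed

lemma rarefaction_iff:
  "rarefaction_profile F r \<longleftrightarrow> profile r \<and> (\<exists>\<tau>>0. \<forall>z. z / \<tau> \<in> superdiff F (r z))"
proof -
  have "(\<exists>p\<in>superdiff F x. \<tau> * p = z) \<longleftrightarrow> z / \<tau> \<in> superdiff F x" if "0 < \<tau>" for \<tau> z x :: real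
    using that by (auto simp: field_simps intro!: bexI[of _ "z / \<tau>"])
  then show ?thesis by (auto simp: rarefaction_profile_def)
qed

lemma rarefaction_exists: "\<exists>r. rarefaction_profile F r"
proof -
  have "\<exists>x. x \<in> {0..1} \<and> z / 1 \<in> superdiff F x" for z
    by (metis superdiff_selection)
  then obtain r where "\<And>z. r z \<in> {0..1}" "\<And>z. z / 1 \<in> superdiff F (r z)" by metis
  then show ?thesis
    using profile_if_superdiff[of 1 r] unfolding rarefaction_iff
    by (intro exI[of _ r]) (auto intro!: exI[of _ 1])
qed

text \<open>On the exceptional null set s is replaced by any state that has z/\<tau> as a
  supergradient. The relation then holds for every z and forces the new function to be a
  profile.\<close>

lemma rarefaction_if_AE:
  assumes s: "profile s" and \<tau>: "0 < \<tau>" and ae: "AE z in lebesgue. z / \<tau> \<in> superdiff F (s z)"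
  shows "\<exists>r. rarefaction_profile F r \<and> (AE z in lebesgue. s z = r z)"
proof -
  have "\<exists>x. x \<in> {0..1} \<and> z / \<tau> \<in> superdiff F x \<and> (z / \<tau> \<in> superdiff F (s z) \<longrightarrow> x = s z)" for z
  proof (cases "z / \<tau> \<in> superdiff F (s z)")
    case True
    then show ?thesis using s by (intro exI[of _ "s z"]) (auto simp: profile_def)
  next
    case False
    then show ?thesis by (metis superdiff_selection)
  qed
  then obtain r where r: "\<And>z. r z \<in> {0..1}" "\<And>z. z / \<tau> \<in> superdiff F (r z)"
    and eq: "\<And>z. z / \<tau> \<in> superdiff F (s z) \<Longrightarrow> r z = s z"
    by metis
  have "rarefaction_profile F r"
    using profile_if_superdiff[OF \<tau>, of r] r \<tau> unfolding rarefaction_iff by blast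
  moreover have "AE z in lebesgue. s z = r z"
    using ae by (auto elim!: eventually_mono simp: eq)
  ultimately show ?thesis by blast
qed

section \<open>The inequality, its equality case and the sharp constant\<close>

lemma flux_eq_0:
  assumes "\<And>x. x \<in> {0..1} \<Longrightarrow> F x = 0" "profile s"
  shows "flux_integral F s = 0"
  using assms by (simp add: flux_integral_def profile_def)

lemma flux_finite:
  assumes "profile s" "moment_integral s < \<infinity>"
  shows "flux_integral F s < \<infinity>"
  using young_integrated[OF assms(1), of 1] assms(2) by (auto simp: le_less_trans)

text \<open>Zero energy forces f = 0 almost everywhere, so all increments of F vanish.\<close>

lemma energy_pos:
  assumes "\<exists>x\<in>{0..1}. F x \<noteq> 0"
  shows "0 < energy"
proof (rule ccontr)
  assume "\<not> 0 < energy"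
  then have "energy = 0" using energy_nonneg by simp
  then have "(LINT x|lborel. indicator {0..1} x *\<^sub>R (f x)\<^sup>2) = 0"
    by (simp add: energy_def set_lebesgue_integral_def)
  then have ae: "AE x in lborel. indicator {0..1} x *\<^sub>R (f x)\<^sup>2 = 0"
    using f_sq unfolding set_integrable_def
    by (subst (asm) integral_nonneg_eq_0_iff_AE) auto
  have "F y = 0" if y: "y \<in> {0..1}" for y
  proof -
    have "integral {0..y} f = 0"
    proof (rule integral_unique, rule has_integral_AE[THEN iffD1])
      show "((\<lambda>_. 0) has_integral 0) {0..y}" by simp
      show "AE x\<in>{0..y} in lborel. 0 = f x"
        using ae by eventually_elim (use y in \<open>auto simp: indicator_def split: if_splits\<close>)
    qed
    then show ?thesis using y f_integral[of 0 y] by (simp add: F0)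
  qed
  then show False using assms by blast
qed

theorem flux_le:
  assumes s: "profile s"
  shows "flux_integral F s \<le> ennreal (sqrt (2 * energy)) * ennreal_sqrt (moment_integral s)"
proof (cases "moment_integral s < \<infinity>")
  case True
  obtain m where m: "0 \<le> m" "moment_integral s = ennreal m"
    using True by (cases "moment_integral s") auto
  obtain a where a: "0 \<le> a" "flux_integral F s = ennreal a"
    using flux_finite[OF s True] by (cases "flux_integral F s") auto
  have "\<tau> * a \<le> m + \<tau>\<^sup>2 * energy / 2" if "0 < \<tau>" for \<tau>
    using young_integrated[OF s that] m a that energy_nonneg
    by (simp flip: ennreal_mult ennreal_plus)
  then have "a \<le> sqrt (2 * energy) * sqrt m"
    using m a energy_nonneg by (intro quadratic_bound_imp_le_sqrt) auto
  then show ?thesis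
    using m a energy_nonneg by (simp add: ennreal_sqrt_def flip: ennreal_mult)
next
  case False
  then have inf: "ennreal_sqrt (moment_integral s) = \<infinity>"
    by (simp add: ennreal_sqrt_def less_top)
  \<comment> \<open>Here 0 * \<infinity> = 0 matters: the right-hand side is infinite only for
    positive energy, so F = 0 is treated apart.\<close>
  show ?thesis
  proof (cases "\<exists>x\<in>{0..1}. F x \<noteq> 0")
    case True
    then show ?thesis using energy_pos inf by (simp add: ennreal_mult_top)
  next
    case False
    then show ?thesis using flux_eq_0[OF _ s] by auto
  qed
qed

text \<open>Finiteness comes first, since it allows the square to be completed in the reals. The
  explicit moment in the last claim is what \<open>flux_const_sharp\<close> divides by.\<close>

theorem flux_eq_if_rarefaction:
  assumes r: "rarefaction_profile F r"
  shows "moment_integral r < \<infinity>"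
    and "flux_integral F r = ennreal (sqrt (2 * energy)) * ennreal_sqrt (moment_integral r)"
    and "\<exists>\<tau>>0. moment_integral r = ennreal (\<tau>\<^sup>2 * energy / 2)"
proof -
  obtain \<tau> where p: "profile r" and \<tau>: "0 < \<tau>" and sd: "\<And>z. z / \<tau> \<in> superdiff F (r z)"
    using r by (auto simp: rarefaction_iff)
  have r01: "r z \<in> {0..1}" for z using p by (auto simp: profile_def)
  \<comment> \<open>Equality at \<open>\<tau>\<close> and the inequality at \<open>2 * \<tau>\<close> together bound the moment density.\<close>
  have "(r z - stratified z) * z \<le> 2 * \<tau> * dual (z / (2 * \<tau>))" for z
  proof -
    have "\<tau> * F (r z) = (r z - stratified z) * z + \<tau> * dual (z / \<tau>)"
      using young_pointwise(2)[OF r01 \<tau>] sd by simp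
    moreover have "2 * \<tau> * F (r z) \<le> (r z - stratified z) * z + 2 * \<tau> * dual (z / (2 * \<tau>))"
      using \<tau> by (intro young_pointwise(1)[OF r01]) simp
    moreover have "0 \<le> \<tau> * dual (z / \<tau>)" using \<tau> dual_nonneg by simp
    ultimately show ?thesis by linarith
  qed
  then have "moment_integral r \<le> (\<integral>\<^sup>+ z. ennreal (2 * \<tau> * dual (z / (2 * \<tau>))) \<partial>lebesgue)"
    unfolding moment_integral_def by (intro nn_integral_mono ennreal_leI)
  also have "\<dots> < \<infinity>" using \<tau> by (simp add: nn_integral_scaled_dual)
  finally show fin: "moment_integral r < \<infinity>" .
  obtain m where m: "0 \<le> m" "moment_integral r = ennreal m"
    using fin by (cases "moment_integral r") auto
  obtain a where a: "0 \<le> a" "flux_integral F r = ennreal a"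
    using flux_finite[OF p fin] by (cases "flux_integral F r") auto
  have eq: "\<tau> * a = m + \<tau>\<^sup>2 * energy / 2"
    using young_integrated_eq[OF p \<tau>] sd m a \<tau> energy_nonneg
    by (simp flip: ennreal_mult ennreal_plus)
  have "a \<le> sqrt (2 * energy) * sqrt m"
    using flux_le[OF p] m a energy_nonneg by (simp add: ennreal_sqrt_def flip: ennreal_mult)
  then have "a \<le> sqrt (2 * energy * m)" by (simp add: real_sqrt_mult)
  then have "a\<^sup>2 \<le> 2 * energy * m"
    using a m energy_nonneg by (metis power_mono real_sqrt_pow2 mult_nonneg_nonneg zero_le_numeral)
  \<comment> \<open>The Young equality gives \<open>2 * energy * m = 2 * \<tau> * a * energy -
    (\<tau> * energy)\<^sup>2\<close>, which completes the square.\<close>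
  moreover have sq: "(a - \<tau> * energy)\<^sup>2 = a\<^sup>2 - 2 * energy * m"
    using eq by (simp add: power2_eq_square algebra_simps) algebra
  ultimately have "(a - \<tau> * energy)\<^sup>2 \<le> 0" by simp
  then have a_eq: "a = \<tau> * energy" by simp
  then have m_eq: "m = \<tau>\<^sup>2 * energy / 2" using eq by (simp add: power2_eq_square)
  then show "\<exists>\<tau>>0. moment_integral r = ennreal (\<tau>\<^sup>2 * energy / 2)" using m \<tau> by auto
  have "a\<^sup>2 = 2 * energy * m" using sq a_eq by simp
  then have "a = sqrt (2 * energy * m)" using a by (metis real_sqrt_unique)
  then have "a = sqrt (2 * energy) * sqrt m" by (simp add: real_sqrt_mult)
  then show "flux_integral F r = ennreal (sqrt (2 * energy)) * ennreal_sqrt (moment_integral r)"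
    using m a energy_nonneg by (simp add: ennreal_sqrt_def flip: ennreal_mult)
qed

text \<open>A single rarefaction profile suffices as a test: it attains equality, and for positive
  energy its moment is finite and positive and cancels.\<close>

theorem flux_const_sharp:
  assumes "0 \<le> C"
    and C: "\<And>s. profile s \<Longrightarrow> flux_integral F s \<le> ennreal C * ennreal_sqrt (moment_integral s)"
  shows "sqrt (2 * energy) \<le> C"
proof (cases "energy = 0")
  case False
  then have e: "0 < energy" using energy_nonneg by simp
  obtain r where r: "rarefaction_profile F r" using rarefaction_exists by blast
  then have "profile r" by (simp add: rarefaction_profile_def)
  obtain \<tau> where \<tau>: "0 < \<tau>" "moment_integral r = ennreal (\<tau>\<^sup>2 * energy / 2)"
    using flux_eq_if_rarefaction(3)[OF r] by blast
  define k where "k = sqrt (\<tau>\<^sup>2 * energy / 2)"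
  have "0 < k" using e \<tau> by (simp add: k_def)
  have "ennreal_sqrt (moment_integral r) = ennreal k"
    using \<tau> e by (simp add: ennreal_sqrt_def k_def)
  with C[OF \<open>profile r\<close>] flux_eq_if_rarefaction(2)[OF r]
  have "ennreal (sqrt (2 * energy)) * ennreal k \<le> ennreal C * ennreal k" by simp
  then have "sqrt (2 * energy) * k \<le> C * k"
    using \<open>0 < k\<close> \<open>0 \<le> C\<close> e by (simp flip: ennreal_mult)
  then show ?thesis using \<open>0 < k\<close> by simp
qed (use assms in simp)

text \<open>For the optimal \<tau> equality in the square-root form is equality in the integrated
  Young inequality. The exclusions are degenerate: for F = 0 both sides always vanish, an infinite
  moment makes equality say only that the flux is infinite, and \<open>stratified\<close> gives 0 =
  0 although it would correspond to \<tau> = 0.\<close>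

theorem rarefaction_if_flux_eq:
  assumes nz: "\<exists>x\<in>{0..1}. F x \<noteq> 0" and s: "profile s" and fin: "moment_integral s < \<infinity>"
    and nstrat: "\<not> (AE z in lebesgue. s z = stratified z)"
    and eq: "flux_integral F s = ennreal (sqrt (2 * energy)) * ennreal_sqrt (moment_integral s)"
  shows "\<exists>r. rarefaction_profile F r \<and> (AE z in lebesgue. s z = r z)"
proof -
  have e: "0 < energy" using energy_pos[OF nz] .
  obtain m where m: "0 \<le> m" "moment_integral s = ennreal m"
    using fin by (cases "moment_integral s") auto
  \<comment> \<open>The moment density is nonnegative, so a zero moment would make s equal to
    \<open>stratified\<close> almost everywhere.\<close>
  have "m \<noteq> 0"
  proof
    assume "m = 0"
    have [measurable]: "s \<in> borel_measurable lebesgue" "(\<lambda>z::real. z) \<in> borel_measurable lebesgue"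
      "stratified \<in> borel_measurable lebesgue"
      using s by (auto simp: profile_def intro!: measurable_completion)
    have s01: "s z \<in> {0..1}" for z using s by (auto simp: profile_def)
    have "(\<lambda>z. ennreal ((s z - stratified z) * z)) \<in> borel_measurable lebesgue" by measurable
    with \<open>m = 0\<close> m have "AE z in lebesgue. ennreal ((s z - stratified z) * z) = 0"
      by (simp add: moment_integral_def nn_integral_0_iff_AE)
    moreover have "AE z in lebesgue. z \<noteq> (0::real)"
      by (rule AE_completion) (rule AE_lborel_singleton)
    ultimately have "AE z in lebesgue. s z = stratified z"
    proof eventually_elim
      fix z assume "ennreal ((s z - stratified z) * z) = 0" "z \<noteq> 0"
      then have "(s z - stratified z) * z = 0"
        using moment_nonneg[OF s01, of z z] by (simp add: ennreal_eq_0_iff)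
      then show "s z = stratified z" using \<open>z \<noteq> 0\<close> by simp
    qed
    then show False using nstrat by blast
  qed
  then have m0: "0 < m" using m by simp
  \<comment> \<open>the minimiser of \<open>m / \<tau> + \<tau> * energy / 2\<close>\<close>
  define \<tau> where "\<tau> = sqrt (2 * m / energy)"
  have \<tau>: "0 < \<tau>" using e m0 by (simp add: \<tau>_def)
  have "\<tau> * (sqrt (2 * energy) * sqrt m) = sqrt ((2 * m / energy) * (2 * energy) * m)"
    by (simp only: \<tau>_def real_sqrt_mult mult.assoc)
  also have "(2 * m / energy) * (2 * energy) * m = (2 * m)\<^sup>2"
    using e by (simp add: field_simps power2_eq_square)
  also have "sqrt \<dots> = 2 * m" using m0 by (intro real_sqrt_unique) auto
  finally have "\<tau> * (sqrt (2 * energy) * sqrt m) = 2 * m" .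
  moreover have "\<tau>\<^sup>2 * energy / 2 = m" using e m0 by (simp add: \<tau>_def)
  ultimately have "\<tau> * (sqrt (2 * energy) * sqrt m) = m + \<tau>\<^sup>2 * energy / 2" by simp
  then have "ennreal \<tau> * flux_integral F s = moment_integral s + ennreal (\<tau>\<^sup>2 * energy / 2)"
    unfolding eq using m m0 e \<tau> by (simp add: ennreal_sqrt_def flip: ennreal_mult ennreal_plus)
  from young_integrated_eqD[OF s \<tau> fin this] show ?thesis
    by (rule rarefaction_if_AE[OF s \<tau>])
qed

end

section \<open>The inequality for Sobolev fluxes\<close>

text \<open>Concavity gives continuity in the interior but allows jumps at 0 and 1; there the growth
  bounds squeeze F between 0 and a function tending to 0.\<close>

lemma continuous_on_if_concave_growth:
  fixes F :: "real \<Rightarrow> real"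
  assumes conc: "concave_on {0..1} F" and F0: "F 0 = 0" and F1: "F 1 = 0" and \<alpha>: "0 < \<alpha>"
    and left: "\<forall>x\<in>{0..1}. F x \<le> C1 * x powr \<alpha>"
    and right: "\<forall>x\<in>{0..1}. F x \<le> C2 * (1 - x) powr \<alpha>"
  shows "continuous_on {0..1} F"
proof -
  have nonneg: "0 \<le> F x" if "x \<in> {0..1}" for x
    using concave_onD[OF conc, of x 0 1] that by (auto simp: F0 F1)
  have "convex_on {0<..<1} (\<lambda>x. - F x)"
    using conc unfolding concave_on_def by (rule convex_on_subset) auto
  then have "continuous_on {0<..<1} (\<lambda>x. - F x)" by (intro convex_on_continuous) auto
  from continuous_on_minus[OF this] have inner: "continuous_on {0<..<1} F" by simp
  have "(F \<longlongrightarrow> F 0) (at_right 0)"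
    unfolding F0
  proof (rule tendsto_sandwich)
    have ev: "\<forall>\<^sub>F x::real in at_right 0. x \<in> {0<..<1}"
      using eventually_at_right_real[of 0 1] by simp
    show "\<forall>\<^sub>F x in at_right 0. 0 \<le> F x"
      using ev by eventually_elim (auto intro!: nonneg)
    show "\<forall>\<^sub>F x in at_right 0. F x \<le> C1 * x powr \<alpha>"
      using ev by eventually_elim (use left in auto)
    have "((\<lambda>x. x powr \<alpha>) \<longlongrightarrow> 0) (at_right (0::real))"
      using ev \<alpha> by (intro tendsto_zero_powrI[of _ _ _ \<alpha>]) (auto elim!: eventually_mono)
    from tendsto_mult[OF tendsto_const[of C1] this]
    show "((\<lambda>x. C1 * x powr \<alpha>) \<longlongrightarrow> 0) (at_right 0)" by simp
  qed auto
  moreover have "(F \<longlongrightarrow> F 1) (at_left 1)"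
    unfolding F1
  proof (rule tendsto_sandwich)
    have ev: "\<forall>\<^sub>F x::real in at_left 1. x \<in> {0<..<1}"
      using eventually_at_left_real[of 0 1] by simp
    show "\<forall>\<^sub>F x in at_left 1. 0 \<le> F x"
      using ev by eventually_elim (auto intro!: nonneg)
    show "\<forall>\<^sub>F x in at_left 1. F x \<le> C2 * (1 - x) powr \<alpha>"
      using ev by eventually_elim (use right in auto)
    have "((\<lambda>x::real. 1 - x) \<longlongrightarrow> 1 - 1) (at_left 1)" by (intro tendsto_intros)
    then have "((\<lambda>x. (1 - x) powr \<alpha>) \<longlongrightarrow> 0) (at_left (1::real))"
      using ev \<alpha> by (intro tendsto_zero_powrI[of _ _ _ \<alpha>]) (auto elim!: eventually_mono)
    from tendsto_mult[OF tendsto_const[of C2] this]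
    show "((\<lambda>x. C2 * (1 - x) powr \<alpha>) \<longlongrightarrow> 0) (at_left 1)" by simp
  qed auto
  ultimately show ?thesis
    using inner by (intro continuous_on_IccI) (auto simp: continuous_on_eq_continuous_at isCont_def)
qed

text \<open>The weak derivative is only Lebesgue measurable, whereas the Tonelli argument uses joint
  measurability over \<open>lborel\<close>.\<close>

lemma borel_representative_unit:
  assumes "set_borel_measurable lebesgue {0<..<1} f'"
  obtains f :: "real \<Rightarrow> real" where "f \<in> borel_measurable borel"
    "AE x in lebesgue. indicator {0<..<1} x * f' x = f x"
proof -
  have "(\<lambda>x. indicator {0<..<1} x * f' x) \<in> borel_measurable lebesgue"
    using assms by (simp add: set_borel_measurable_def)
  from completion_ex_borel_measurable_real[OF this] obtain f where
    "f \<in> borel_measurable lborel" "AE x in lborel. indicator {0<..<1} x * f' x = f x" by blast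
  then show ?thesis by (intro that[of f] AE_completion) auto
qed

text \<open>Lebesgue data on the open interval and Borel data on the closed one differ only on a
  null set, so the energy is the same. The increment formula is first obtained strictly inside
  (0,1).\<close>

lemma concave_flux_if_W12:
  assumes W: "W12_unit F F'" and conc: "concave_on {0..1} F" and F0: "F 0 = 0" and F1: "F 1 = 0"
    and cont: "continuous_on {0..1} F"
    and f: "f \<in> borel_measurable borel" and ae: "AE x in lebesgue. indicator {0<..<1} x * F' x = f x"
  shows "concave_flux F f"
    and "(LINT x:{0<..<1}|lebesgue. (F' x)\<^sup>2) = (LINT x:{0..1}|lborel. (f x)\<^sup>2)"
proof -
  have wd: "weak_derivative_unit F F'" and L2: "L2_unit F'" using W by (auto simp: W12_unit_def)
  have ae01: "AE x in lebesgue. x \<noteq> 0 \<and> x \<noteq> (1::real)"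
    by (intro AE_conjI) (auto intro!: AE_completion AE_lborel_singleton)
  have ae_ind: "AE x in lebesgue. indicator {0<..<1} x *\<^sub>R F' x = indicator {0..1} x *\<^sub>R f x"
    using ae ae01
  proof eventually_elim
    case (elim x)
    then show ?case by (cases "x \<in> {0<..<1}"; cases "x \<in> {0..1}") auto
  qed
  have ae_sq: "AE x in lebesgue. indicator {0<..<1} x *\<^sub>R (F' x)\<^sup>2 = indicator {0..1} x *\<^sub>R (f x)\<^sup>2"
    using ae_ind by eventually_elim (auto simp: indicator_def split: if_splits)
  have [measurable]: "f \<in> borel_measurable borel" by (rule f)
  have ind_meas: "(\<lambda>x. indicator {0<..<1} x *\<^sub>R F' x) \<in> borel_measurable lebesgue"
    using L2 by (simp add: L2_unit_def set_borel_measurable_def)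
  have F'2: "integrable lebesgue (\<lambda>x. indicator {0<..<1} x *\<^sub>R (F' x)\<^sup>2)"
    using L2 by (simp add: L2_unit_def set_integrable_def)
  have f2_meas: "(\<lambda>x. indicator {0..1} x *\<^sub>R (f x)\<^sup>2) \<in> borel_measurable lebesgue"
    by (intro measurable_completion) measurable
  have "integrable lebesgue (\<lambda>x. indicator {0..1} x *\<^sub>R (f x)\<^sup>2)"
    using F'2 f2_meas by (rule integrable_cong_AE_imp) (use ae_sq in \<open>auto elim: eventually_mono\<close>)
  then have f2: "set_integrable lborel {0..1} (\<lambda>x. (f x)\<^sup>2)"
    unfolding set_integrable_def by (subst (asm) integrable_completion) auto
  have "(LINT x|lebesgue. indicator {0<..<1} x *\<^sub>R (F' x)\<^sup>2) = (LINT x|lebesgue. indicator {0..1} x *\<^sub>R (f x)\<^sup>2)"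
    using borel_measurable_integrable[OF F'2] f2_meas ae_sq by (rule integral_cong_AE)
  also have "\<dots> = (LINT x|lborel. indicator {0..1} x *\<^sub>R (f x)\<^sup>2)"
    by (rule integral_completion) measurable
  finally show "(LINT x:{0<..<1}|lebesgue. (F' x)\<^sup>2) = (LINT x:{0..1}|lborel. (f x)\<^sup>2)"
    by (simp add: set_lebesgue_integral_def)
  have fi: "set_integrable lborel {0..1} f"
    unfolding set_integrable_def
  proof (rule Bochner_Integration.integrable_bound)
    have "set_integrable lborel {0..1::real} (\<lambda>_. 1::real)" by (simp add: set_integrable_def)
    from set_integral_add(1)[OF this f2]
    show "integrable lborel (\<lambda>x. indicator {0..1} x *\<^sub>R (1 + (f x)\<^sup>2))"
      by (simp add: set_integrable_def)
    \<comment> \<open>This bound puts L^2 inside L^1 on a bounded interval.\<close>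
    have "\<bar>y\<bar> \<le> 1 + y\<^sup>2" for y :: real
      using sum_squares_ge_zero[of "\<bar>y\<bar> - 1/2" 0] by (simp add: power2_eq_square algebra_simps)
    then show "AE x in lborel. norm (indicator {0..1} x *\<^sub>R f x) \<le> norm (indicator {0..1} x *\<^sub>R (1 + (f x)\<^sup>2))"
      by (intro AE_I2) (auto simp: indicator_def intro: order_trans[OF _ abs_ge_self])
  qed measurable
  then have f_abs: "f absolutely_integrable_on {0..1}"
    unfolding set_integrable_def by (subst integrable_completion) auto
  then have "integrable lebesgue (\<lambda>x. indicator {0<..<1} x *\<^sub>R F' x)"
    unfolding set_integrable_def
    by (rule integrable_cong_AE_imp) (use ae_ind ind_meas in auto)
  then have F'i: "set_integrable lebesgue {0<..<1} F'" by (simp add: set_integrable_def)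
  obtain B where B: "\<And>x. x \<in> {0..1} \<Longrightarrow> \<bar>F x\<bar> \<le> B"
    using compact_imp_bounded[OF compact_continuous_image[OF cont compact_Icc]]
    unfolding bounded_iff by fastforce
  have incr: "integral {a..b} f = F b - F a" if ab: "0 < a" "a < b" "b < 1" for a b
  proof -
    have "(LINT x:{a..b}|lebesgue. F' x) = (LINT x:{a..b}|lebesgue. f x)"
      unfolding set_lebesgue_integral_def
    proof (rule integral_cong_AE)
      have "set_integrable lebesgue {a..b} F'"
        by (rule set_integrable_subset[OF F'i]) (use ab in auto)
      then show "(\<lambda>x. indicator {a..b} x *\<^sub>R F' x) \<in> borel_measurable lebesgue"
        unfolding set_integrable_def by (rule borel_measurable_integrable)
      show "AE x in lebesgue. indicator {a..b} x *\<^sub>R F' x = indicator {a..b} x *\<^sub>R f x"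
        using ae by eventually_elim (use ab in \<open>auto simp: indicator_def split: if_splits\<close>)
      show "(\<lambda>x. indicator {a..b} x *\<^sub>R f x) \<in> borel_measurable lebesgue"
        by (intro measurable_completion) measurable
    qed
    also have "\<dots> = integral {a..b} f"
      by (intro set_lebesgue_integral_eq_integral set_integrable_subset[OF f_abs]) (use ab in auto)
    finally show ?thesis
      using weak_derivative_unit_increment[OF wd continuous_on_subset[OF cont] _ F'i ab, of B] B by force
  qed
  \<comment> \<open>The interior increments make G constant on (0,1), and continuity carries this to
    the end points.\<close>
  define G where "G x = F x - integral {0..x} f" for x
  have f_int: "f integrable_on {0..1}" using f_abs by (simp add: absolutely_integrable_on_def)
  have G_cont: "continuous_on {0..1} G"
    unfolding G_def[abs_def] by (intro continuous_on_diff cont indefinite_integral_continuous_1 f_int)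
  have split: "integral {0..x} f + integral {x..y} f = integral {0..y} f"
    if "0 \<le> x" "x \<le> y" "y \<le> 1" for x y
    using that integrable_subinterval_real[OF f_int, of 0 y]
    by (intro Henstock_Kurzweil_Integration.integral_combine) auto
  have G_eq: "G x = G (1/2)" if "x \<in> {0<..<1}" for x
  proof (cases x "1/2::real" rule: linorder_cases)
    case less
    then show ?thesis using incr[of x "1/2"] split[of x "1/2"] that by (simp add: G_def)
  next
    case equal
    then show ?thesis by (rule arg_cong)
  next
    case greater
    then show ?thesis using incr[of "1/2" x] split[of "1/2" x] that by (simp add: G_def)
  qed
  have const: "G x = G (1/2)" if "x \<in> {0..1}" for x
  proof (rule continuous_constant_on_closure[where S = "{0<..<1}" and f = G])
    show "continuous_on (closure {0<..<1}) G" "x \<in> closure {0<..<1}"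
      using G_cont that by simp_all
  qed (rule G_eq)
  show "concave_flux F f"
  proof
    show "integral {x..y} f = F y - F x" if "0 \<le> x" "x \<le> y" "y \<le> 1" for x y
      using const[of x] const[of y] split[OF that] that by (simp add: G_def)
  qed (fact conc F0 F1 f f_abs f2)+
qed

text \<open>The integrals do not see null sets, so equality determines s only almost everywhere. The
  direction from rarefaction waves to equality stands alone because it includes F = 0 and also
  yields a finite moment.\<close>

theorem theorem3:
  fixes F F' :: "real \<Rightarrow> real" and C1 C2 \<alpha> :: real
  assumes "W12_unit F F'"
    and "concave_on {0..1} F"
    and "F 0 = 0" and "F 1 = 0"
    and "C1 > 0" and "C2 > 0" and "\<alpha> > 1/2"
    and "\<forall>x\<in>{0..1}. F x \<le> C1 * x powr \<alpha>"
    and "\<forall>x\<in>{0..1}. F x \<le> C2 * (1 - x) powr \<alpha>"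
  shows "(\<forall>s. profile s \<longrightarrow>
            flux_integral F s \<le> ennreal (sharp_const F') * ennreal_sqrt (moment_integral s))
    \<and> (\<forall>C\<ge>0. (\<forall>s. profile s \<longrightarrow>
                 flux_integral F s \<le> ennreal C * ennreal_sqrt (moment_integral s)) \<longrightarrow>
              sharp_const F' \<le> C)
    \<and> (\<forall>s. profile s \<longrightarrow> (\<exists>r. rarefaction_profile F r \<and> (AE z in lebesgue. s z = r z)) \<longrightarrow>
            moment_integral s < \<infinity> \<and>
            flux_integral F s = ennreal (sharp_const F') * ennreal_sqrt (moment_integral s))
    \<and> ((\<exists>x\<in>{0..1}. F x \<noteq> 0) \<longrightarrow>
        (\<forall>s. profile s \<longrightarrow> moment_integral s < \<infinity> \<longrightarrow>
            \<not> (AE z in lebesgue. s z = stratified z) \<longrightarrow>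
            (flux_integral F s = ennreal (sharp_const F') * ennreal_sqrt (moment_integral s) \<longleftrightarrow>
             (\<exists>r. rarefaction_profile F r \<and> (AE z in lebesgue. s z = r z)))))"
proof -
  have cont: "continuous_on {0..1} F"
    using assms by (intro continuous_on_if_concave_growth[of F \<alpha> C1 C2]) auto
  have "set_borel_measurable lebesgue {0<..<1} F'"
    using assms(1) by (simp add: W12_unit_def L2_unit_def)
  then obtain f where f: "f \<in> borel_measurable borel"
    and ae: "AE x in lebesgue. indicator {0<..<1} x * F' x = f x"
    by (rule borel_representative_unit)
  note flux = concave_flux_if_W12[OF assms(1-4) cont f ae]
  interpret concave_flux F f by (rule flux(1))
  have const: "sharp_const F' = sqrt (2 * energy)"
    by (simp add: sharp_const_def energy_def flux(2))
  have eq: "moment_integral s < \<infinity> \<and>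
      flux_integral F s = ennreal (sqrt (2 * energy)) * ennreal_sqrt (moment_integral s)"
    if "\<exists>r. rarefaction_profile F r \<and> (AE z in lebesgue. s z = r z)" for s
    using that flux_eq_if_rarefaction(1,2) flux_integral_cong_AE moment_integral_cong_AE by metis
  show ?thesis
    unfolding const
    using flux_le flux_const_sharp eq rarefaction_if_flux_eq by blast
qed

end
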